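(* Let $G$ be either $BS(1,N)=\langle a,t\mid tat^{-1}=a^N\rangle$ for an integer $N$ with $|N|\ge2$, or $\mathbb{Z}^m\rtimes_T\mathbb{Z}$ where $m\ge1$ and $T\in SL(m,\mathbb{Z})$ has an eigenvalue $\lambda\in\mathbb{C}$ with $|\lambda|>1$. Let $r\ge 1$ be an integer. Then for every finite generating set $Y$ of $G$, the set $$\mathcal{N}_r(G)=\{(x_0,\ldots,x_r)\in G^{r+1}\mid [x_0,\ldots,x_r]=1\}$$ is exponentially negligible in $G^{r+1}$ with respect to $Y$.
   Context: $\mathbb{Z}^m\rtimes_T\mathbb{Z}$ denotes the semidirect product in which the generator $1\in\mathbb{Z}$ acts on $\mathbb{Z}^m$ by $\mathbf{u}\mapsto T\mathbf{u}$. Commutators: $[x_0,x_1]=x_0^{-1}x_1^{-1}x_0x_1$ and inductively $[x_0,\ldots,x_r]=[[x_0,\ldots,x_{r-1}],x_r]$. For a finite generating set $Y$ of a group $G$, let $|g|_Y$ be the minimal length of a word in the elements of $Y$ and their inverses representing $g\in G$, and for $n \in \mathbb{Z}_{\ge 0}$ let $B_Y(n)=\{g\in G \mid |g|_Y\le n\}$. For an integer $s\ge1$, a subset $\mathcal{A}\subseteq G^s$ is exponentially negligible in $G^s$ with respect to $Y$ if $$\limsup_{n\to\infty}\sqrt[n]{\frac{|\mathcal{A}\cap B_Y(n)^s|}{|B_Y(n)|^s}}<1.$$ *)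

theory Defs
  imports
    "HOL-Algebra.Generated_Groups"
    "HOL-Library.Extended_Real"
    "HOL-Library.Liminf_Limsup"
    "Jordan_Normal_Form.Char_Poly"
begin

subsection \<open>Group presentations\<close>

text \<open>
  A word is a list of signed letters: \<open>(x, True)\<close> stands for the generator \<open>x\<close> and
  \<open>(x, False)\<close> for its formal inverse.  A relation \<open>l = r\<close> is the pair \<open>(l, r)\<close>.
  The generators are all elements of the type \<open>'x\<close>.
\<close>

type_synonym 'x word = "('x \<times> bool) list"

inductive word_equiv :: "('x word \<times> 'x word) set \<Rightarrow> 'x word \<Rightarrow> 'x word \<Rightarrow> bool"
  for R where
  refl: "word_equiv R u u"
| sym: "word_equiv R u v \<Longrightarrow> word_equiv R v u"
| trans: "word_equiv R u v \<Longrightarrow> word_equiv R v w \<Longrightarrow> word_equiv R u w"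
| cancel: "word_equiv R (u @ [(x, b), (x, \<not> b)] @ v) (u @ v)"
| relation: "(l, r) \<in> R \<Longrightarrow> word_equiv R (u @ l @ v) (u @ r @ v)"

definition word_class :: "('x word \<times> 'x word) set \<Rightarrow> 'x word \<Rightarrow> 'x word set" where
  "word_class R u = {v. word_equiv R u v}"

definition presented_group :: "('x word \<times> 'x word) set \<Rightarrow> 'x word set monoid" where
  "presented_group R =
    \<lparr>carrier = range (word_class R),
     monoid.mult = (\<lambda>A B. \<Union>u\<in>A. \<Union>v\<in>B. word_class R (u @ v)),
     one = word_class R []\<rparr>"

lemma word_equiv_append:
  assumes "word_equiv R u u'" "word_equiv R v v'"
  shows "word_equiv R (u @ v) (u' @ v')"
proof -
  have ctx: "word_equiv R (p @ u @ q) (p @ u' @ q)" if "word_equiv R u u'" for p q u u'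
    using that
  proof (induction rule: word_equiv.induct)
    case (cancel u x b v)
    show ?case using word_equiv.cancel[of R "p @ u" x b "v @ q"] by simp
  next
    case (relation l r u v)
    then show ?case using word_equiv.relation[of l r R "p @ u" "v @ q"] by simp
  next
    case (trans u v w)
    from trans.IH show ?case by (rule word_equiv.trans)
  next
    case (sym u v)
    from sym.IH show ?case by (rule word_equiv.sym)
  qed (rule word_equiv.refl)
  have "word_equiv R (u @ v) (u' @ v)" "word_equiv R (u' @ v) (u' @ v')"
    using ctx[OF assms(1), of "[]" v] ctx[OF assms(2), of u' "[]"] by simp_all
  then show ?thesis by (rule word_equiv.trans)
qed

lemma word_class_eq_iff: "word_class R u = word_class R v \<longleftrightarrow> word_equiv R u v"
proof
  assume "word_class R u = word_class R v"
  then have "v \<in> word_class R u" by (simp add: word_class_def word_equiv.refl)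
  then show "word_equiv R u v" by (simp add: word_class_def)
next
  assume "word_equiv R u v"
  then show "word_class R u = word_class R v"
    unfolding word_class_def
    by (intro Collect_cong iffI) (erule word_equiv.trans[OF word_equiv.sym] word_equiv.trans, assumption)+
qed

lemma presented_group_mult:
  "word_class R u \<otimes>\<^bsub>presented_group R\<^esub> word_class R v = word_class R (u @ v)"
proof -
  have "word_class R (u' @ v') = word_class R (u @ v)"
    if "u' \<in> word_class R u" "v' \<in> word_class R v" for u' v'
  proof -
    have "word_equiv R u u'" "word_equiv R v v'" using that by (simp_all add: word_class_def)
    then have "word_equiv R (u @ v) (u' @ v')" by (rule word_equiv_append)
    then show ?thesis unfolding word_class_eq_iff by (rule word_equiv.sym)
  qed
  moreover have "u \<in> word_class R u" "v \<in> word_class R v"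
    by (auto simp: word_class_def intro: word_equiv.refl)
  ultimately have "(\<Union>u'\<in>word_class R u. \<Union>v'\<in>word_class R v. word_class R (u' @ v'))
      = word_class R (u @ v)" by blast
  then show ?thesis by (simp add: presented_group_def)
qed

definition inv_word :: "'x word \<Rightarrow> 'x word" where
  "inv_word u = rev (map (\<lambda>(x, b). (x, \<not> b)) u)"

lemma word_equiv_inv_word: "word_equiv R (inv_word u @ u) []"
proof (induction u)
  case Nil
  then show ?case by (simp add: inv_word_def word_equiv.refl)
next
  case (Cons a u)
  obtain x b where a: "a = (x, b)" by force
  have "word_equiv R (inv_word u @ [(x, \<not> b), (x, \<not> \<not> b)] @ u) (inv_word u @ u)"
    by (rule word_equiv.cancel)
  then have "word_equiv R (inv_word u @ [(x, \<not> b), (x, \<not> \<not> b)] @ u) []"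
    using Cons by (rule word_equiv.trans)
  then show ?case
    by (simp add: a inv_word_def)
qed

lemma group_presented_group: "group (presented_group R)"
proof -
  have carrier: "carrier (presented_group R) = range (word_class R)"
    and one: "\<one>\<^bsub>presented_group R\<^esub> = word_class R []"
    by (simp_all add: presented_group_def)
  show ?thesis
  proof (rule groupI)
    fix A assume "A \<in> carrier (presented_group R)"
    then obtain u where u: "A = word_class R u" by (auto simp: carrier)
    have "word_class R (inv_word u) \<otimes>\<^bsub>presented_group R\<^esub> A = \<one>\<^bsub>presented_group R\<^esub>"
      using word_equiv_inv_word[of R u] by (simp add: u one presented_group_mult word_class_eq_iff)
    then show "\<exists>B\<in>carrier (presented_group R).
        B \<otimes>\<^bsub>presented_group R\<^esub> A = \<one>\<^bsub>presented_group R\<^esub>" by (auto simp: carrier)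
  qed (auto simp: carrier one presented_group_mult)
qed

subsection \<open>The Baumslag--Solitar groups \<open>BS(1,N)\<close>\<close>

datatype bs_gen = BS_a | BS_t

definition word_pow :: "'x \<Rightarrow> int \<Rightarrow> 'x word" where
  "word_pow x k = replicate (nat \<bar>k\<bar>) (x, 0 \<le> k)"

definition BS1 :: "int \<Rightarrow> bs_gen word set monoid" where
  "BS1 N = presented_group {([(BS_t, True), (BS_a, True), (BS_t, False)], word_pow BS_a N)}"

subsection \<open>The semidirect products of \<open>\<int>\<^sup>m\<close> with \<open>\<int>\<close>\<close>

definition SL_int :: "nat \<Rightarrow> int mat monoid" where
  "SL_int m =
    \<lparr>carrier = {T \<in> carrier_mat m m. Determinant.det T = 1}, monoid.mult = (*), one = 1\<^sub>m m\<rparr>"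

text \<open>The powers of \<open>T\<close> with negative exponents are taken in the group \<open>SL(m, \<int>)\<close>.\<close>

definition semidirect_Z :: "nat \<Rightarrow> int mat \<Rightarrow> (int vec \<times> int) monoid" where
  "semidirect_Z m T =
    \<lparr>carrier = carrier_vec m \<times> UNIV,
     monoid.mult = (\<lambda>(u, k) (v, l). (u + (T [^]\<^bsub>SL_int m\<^esub> k) *\<^sub>v v, k + l)),
     one = (0\<^sub>v m, 0)\<rparr>"

lemma group_SL_int: "group (SL_int m)"
proof (rule groupI)
  fix A assume "A \<in> carrier (SL_int m)"
  then have A: "A \<in> carrier_mat m m" "Determinant.det A = 1" by (auto simp: SL_int_def)
  have adj: "adj_mat A \<in> carrier_mat m m" "adj_mat A * A = 1\<^sub>m m"
    using adj_mat[OF A(1)] A(2) by auto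
  have "Determinant.det (adj_mat A) = 1"
    using det_mult[OF adj(1) A(1)] adj(2) A(2) by simp
  then show "\<exists>B\<in>carrier (SL_int m). B \<otimes>\<^bsub>SL_int m\<^esub> A = \<one>\<^bsub>SL_int m\<^esub>"
    using adj by (intro bexI[of _ "adj_mat A"]) (auto simp: SL_int_def)
qed (auto simp: SL_int_def det_mult)

lemma group_semidirect_Z:
  assumes T: "T \<in> carrier (SL_int m)"
  shows "group (semidirect_Z m T)"
proof -
  interpret SL: group "SL_int m" by (rule group_SL_int)
  let ?P = "\<lambda>k::int. T [^]\<^bsub>SL_int m\<^esub> k"
  have P: "?P k \<in> carrier_mat m m" for k
    using SL.int_pow_closed[OF T, of k] by (simp add: SL_int_def)
  have P0: "?P 0 = 1\<^sub>m m" by (simp add: SL_int_def)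
  have Padd: "?P (k + l) = ?P k * ?P l" for k l
    using SL.int_pow_mult[OF T, of k l] by (simp add: SL_int_def)
  have Pv: "?P k *\<^sub>v v \<in> carrier_vec m" if "v \<in> carrier_vec m" for k v
    using mult_mat_vec_carrier[OF P that] .
  show ?thesis
  proof (rule groupI)
    fix x assume "x \<in> carrier (semidirect_Z m T)"
    then obtain u k where x: "x = (u, k)" "u \<in> carrier_vec m" by (auto simp: semidirect_Z_def)
    let ?y = "(- (?P (- k) *\<^sub>v u), - k)"
    have "?y \<in> carrier (semidirect_Z m T)" "?y \<otimes>\<^bsub>semidirect_Z m T\<^esub> x = \<one>\<^bsub>semidirect_Z m T\<^esub>"
      using x Pv[OF x(2)] by (auto simp: semidirect_Z_def)
    then show "\<exists>y\<in>carrier (semidirect_Z m T). y \<otimes>\<^bsub>semidirect_Z m T\<^esub> x = \<one>\<^bsub>semidirect_Z m T\<^esub>"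
      by blast
  next
    fix x y z
    assume "x \<in> carrier (semidirect_Z m T)" "y \<in> carrier (semidirect_Z m T)"
      "z \<in> carrier (semidirect_Z m T)"
    then obtain u k v l w j where xyz: "x = (u, k)" "y = (v, l)" "z = (w, j)"
      and carr: "u \<in> carrier_vec m" "v \<in> carrier_vec m" "w \<in> carrier_vec m"
      by (auto simp: semidirect_Z_def)
    have "?P k *\<^sub>v (v + ?P l *\<^sub>v w) = ?P k *\<^sub>v v + ?P (k + l) *\<^sub>v w"
      using mult_add_distrib_mat_vec[OF P carr(2) Pv[OF carr(3)]]
        assoc_mult_mat_vec[OF P P carr(3)] by (simp add: Padd)
    then show "x \<otimes>\<^bsub>semidirect_Z m T\<^esub> y \<otimes>\<^bsub>semidirect_Z m T\<^esub> z
        = x \<otimes>\<^bsub>semidirect_Z m T\<^esub> (y \<otimes>\<^bsub>semidirect_Z m T\<^esub> z)"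
      using carr Pv by (simp add: xyz semidirect_Z_def assoc_add_vec[of _ m])
  qed (use Pv P0 in \<open>auto simp: semidirect_Z_def\<close>)
qed

subsection \<open>Iterated commutators\<close>

definition group_comm :: "('a, 'b) monoid_scheme \<Rightarrow> 'a \<Rightarrow> 'a \<Rightarrow> 'a" where
  "group_comm G x y = inv\<^bsub>G\<^esub> x \<otimes>\<^bsub>G\<^esub> inv\<^bsub>G\<^esub> y \<otimes>\<^bsub>G\<^esub> x \<otimes>\<^bsub>G\<^esub> y"

text \<open>Only meaningful for nonempty lists: \<open>[x\<^sub>0, \<dots>, x\<^sub>r]\<close> is bracketed to the left.\<close>

definition iterated_comm :: "('a, 'b) monoid_scheme \<Rightarrow> 'a list \<Rightarrow> 'a" where
  "iterated_comm G xs = foldl (group_comm G) (hd xs) (tl xs)"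

subsection \<open>Word length and exponential negligibility\<close>

text \<open>Elements of \<open>B\<^sup>s\<close> are represented as lists of length \<open>s\<close>.\<close>

definition tuples :: "'a set \<Rightarrow> nat \<Rightarrow> 'a list set" where
  "tuples B s = {xs. length xs = s \<and> set xs \<subseteq> B}"

definition word_length :: "('a, 'b) monoid_scheme \<Rightarrow> 'a set \<Rightarrow> 'a \<Rightarrow> nat" where
  "word_length G Y g =
    (LEAST n. \<exists>ws. length ws = n \<and> set ws \<subseteq> Y \<union> m_inv G ` Y \<and> foldr (monoid.mult G) ws \<one>\<^bsub>G\<^esub> = g)"

definition word_ball :: "('a, 'b) monoid_scheme \<Rightarrow> 'a set \<Rightarrow> nat \<Rightarrow> 'a set" where
  "word_ball G Y n = {g \<in> carrier G. word_length G Y g \<le> n}"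

definition finite_generating_set :: "('a, 'b) monoid_scheme \<Rightarrow> 'a set \<Rightarrow> bool" where
  "finite_generating_set G Y \<longleftrightarrow> finite Y \<and> Y \<subseteq> carrier G \<and> generate G Y = carrier G"

definition exp_negligible ::
  "('a, 'b) monoid_scheme \<Rightarrow> 'a set \<Rightarrow> nat \<Rightarrow> 'a list set \<Rightarrow> bool" where
  "exp_negligible G Y s \<A> \<longleftrightarrow> \<A> \<subseteq> tuples (carrier G) s \<and>
    limsup (\<lambda>n. ereal (root n (real (card (\<A> \<inter> tuples (word_ball G Y n) s)) /
                              real (card (word_ball G Y n)) ^ s))) < 1"

definition comm_tuples :: "('a, 'b) monoid_scheme \<Rightarrow> nat \<Rightarrow> 'a list set" where
  "comm_tuples G r = {xs \<in> tuples (carrier G) (r + 1). iterated_comm G xs = \<one>\<^bsub>G\<^esub>}"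

end

theory Submission
  imports Defs
begin

text \<open>
  Each group \<open>G\<close> in question acts on the complex line by affine maps
  \<open>z \<mapsto> \<mu> ^ \<kappa> x * z + \<beta> x\<close> with \<open>\<bar>\<mu>\<bar> > 1\<close>, where the height \<open>\<kappa> : G \<rightarrow> \<int>\<close> is a surjective homomorphism
  with abelian kernel.  For \<open>BS(1,N)\<close> one has \<open>\<mu> = N\<close>; for the semidirect product, \<open>\<mu>\<close> is the given
  eigenvalue of \<open>T\<close> and \<open>\<beta>\<close> pairs the vector component with an eigenvector of the transpose of \<open>T\<close>.
  The locale \<open>height_group\<close> records this situation, which is all that the argument uses.

  Commutators act as translations, and commuting a translation by \<open>b\<close> with an element \<open>x\<close> gives
  the translation by \<open>(\<mu> ^ (- \<kappa> x) - 1) * b\<close>.  So \<open>[x\<^sub>0, \<dots>, x\<^sub>r] = 1\<close> forces either \<open>\<kappa> x\<^sub>i = 0\<close> for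
  some \<open>i \<ge> 1\<close>, or \<open>\<kappa> x\<^sub>1 \<noteq> 0\<close> and \<open>x\<^sub>0\<close> commutes with \<open>x\<^sub>1\<close> as an affine map.  In the second case \<open>x\<^sub>0\<close>
  fixes the fixed point of \<open>x\<^sub>1\<close>, hence \<open>\<beta> x\<^sub>0\<close> is a function of \<open>\<kappa> x\<^sub>0\<close>.  Fixing all entries but one, it
  remains to bound the proportion in the ball of radius \<open>n\<close> of the kernel of \<open>\<kappa>\<close>, and of any set on
  which \<open>\<kappa>\<close> determines \<open>\<beta>\<close>, by an exponentially small quantity that is the same for all these sets
  (\<open>exponentially_small_sets\<close>).

  This bound compares exponential growth rates.  If all prefixes of a word of length \<open>n\<close> have height at
  most \<open>\<epsilon> n\<close>, then, the kernel being abelian, its value is determined by its final height and by how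
  often each letter is used at each height.  There are few such counting functions (\<open>card_low\<close>).
  Any other word has a prefix \<open>p\<close> that reaches height \<open>\<epsilon> n\<close>, say \<open>x = p r\<close>.  On its way it passes all
  lower heights, and at a height \<open>h\<close> one may insert a word of bounded length so that \<open>p\<close> is multiplied
  on the left by \<open>t\<^sup>h a t\<^sup>-\<^sup>h\<close>, a translation by \<open>\<mu>\<^sup>h \<beta>(a)\<close> (\<open>bump_mult_in_ball\<close>).  Doing so at a set
  \<open>I\<close> of \<open>j\<close> heights out of \<open>R j\<close> equally spaced ones turns \<open>p\<close> into \<open>\<alpha>\<^sub>I p\<close>, and \<open>\<alpha>\<^sub>I\<close> determines \<open>I\<close>.
  If \<open>\<kappa>\<close> determines \<open>\<beta>\<close> on a set \<open>X\<close>, then \<open>x \<in> X\<close> and \<open>I\<close> are recovered from \<open>\<alpha>\<^sub>I x\<close>.  If \<open>\<kappa> x = 0\<close>,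
  then \<open>inv r\<close> has the same height as \<open>p\<close>, so \<open>\<alpha>\<^sub>I\<close> is inserted cheaply there as well, and \<open>x\<close>, being
  equal to \<open>(\<alpha>\<^sub>I p) inv(\<alpha>\<^sub>I inv r)\<close>, and then \<open>I\<close> are recovered from the pair
  \<open>(\<alpha>\<^sub>I p, \<alpha>\<^sub>I inv r)\<close>.  Either way each \<open>x\<close> yields at least \<open>R ^ j\<close> pairs of elements of total length at
  most \<open>n + O(j)\<close> (\<open>insertion_count\<close>).  With \<open>\<gamma>\<close> the growth rate of the balls, the number of such
  pairs is \<open>\<gamma> ^ (n + O(j))\<close> up to a subexponential factor, because products of two balls obey the
  same growth rate.  For \<open>R\<close> large, \<open>R ^ j\<close> beats \<open>\<gamma> ^ O(j)\<close>, which is an exponential saving since \<open>j\<close>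
  is proportional to \<open>n\<close>.
\<close>

section \<open>Counting and growth rates\<close>

text \<open>
  The growth rate is the infimum of the \<open>n\<close>-th roots, as in Fekete's lemma.  Submultiplicativity
  makes a good upper bound at a single argument propagate to all larger ones, which is why the rate
  in the upper bound exceeds the infimum by a factor \<open>\<zeta>\<close> that may be arbitrarily close to \<open>1\<close>.
\<close>

lemma submultiplicative_growth_rate:
  fixes b :: "nat \<Rightarrow> real"
  assumes b1: "\<And>n. 1 \<le> b n" and sub: "\<And>m n. b (m + n) \<le> b m * b n"
  obtains \<gamma> where "1 \<le> \<gamma>" "\<And>n. \<gamma> ^ n \<le> b n"
    "\<And>\<zeta>. 1 < \<zeta> \<Longrightarrow> \<exists>C>0. \<forall>n. b n \<le> C * (\<zeta> * \<gamma>) ^ n"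
    "\<And>\<delta>. 0 \<le> \<delta> \<Longrightarrow> (\<And>n. \<delta> ^ n \<le> b n) \<Longrightarrow> \<delta> \<le> \<gamma>"
proof -
  define A where "A = (\<lambda>n. root n (b n)) ` {1..}"
  define \<gamma> where "\<gamma> = Inf A"
  have bdd: "bdd_below A"
    unfolding A_def by (rule bdd_belowI[of _ 0]) (use b1 in \<open>auto intro!: real_root_ge_zero order_trans[OF zero_le_one]\<close>)
  have ne: "A \<noteq> {}" by (auto simp: A_def)
  have bpos: "0 < b n" for n using b1[of n] by linarith
  have lower: "\<delta> \<le> \<gamma>" if "0 \<le> \<delta>" and d: "\<And>n. \<delta> ^ n \<le> b n" for \<delta>
    unfolding \<gamma>_def
  proof (rule cInf_greatest[OF ne])
    fix x assume "x \<in> A"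
    then obtain n where n: "n \<ge> 1" "x = root n (b n)" by (auto simp: A_def)
    have "\<delta> = root n (\<delta> ^ n)" using n \<open>0 \<le> \<delta>\<close> by (simp add: real_root_power_cancel)
    also have "\<dots> \<le> x" using n d by simp
    finally show "\<delta> \<le> x" .
  qed
  have g1: "1 \<le> \<gamma>" by (rule lower) (use b1 in auto)
  have pow: "\<gamma> ^ n \<le> b n" for n
  proof (cases "n = 0")
    case False
    then have "\<gamma> \<le> root n (b n)" unfolding \<gamma>_def by (intro cInf_lower[OF _ bdd]) (auto simp: A_def)
    then have "\<gamma> ^ n \<le> root n (b n) ^ n" using g1 by (intro power_mono) auto
    then show ?thesis using False bpos[of n] by simp
  qed (use b1[of 0] in simp)
  have upper: "\<exists>C>0. \<forall>n. b n \<le> C * (\<zeta> * \<gamma>) ^ n" if z: "1 < \<zeta>" for \<zeta>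
  proof -
    have "\<gamma> < \<zeta> * \<gamma>" using z g1 by simp
    then obtain x where "x \<in> A" "x < \<zeta> * \<gamma>" using cInf_lessD[OF ne] unfolding \<gamma>_def by blast
    then obtain k where k: "k \<ge> 1" "root k (b k) < \<zeta> * \<gamma>" by (auto simp: A_def)
    define h where "h = \<zeta> * \<gamma>"
    have h1: "1 \<le> h" unfolding h_def using z g1 by (meson less_imp_le mult_ge1_I)
    have "b k = root k (b k) ^ k" using k bpos[of k] by simp
    also have "\<dots> \<le> h ^ k" unfolding h_def using k bpos[of k]
      by (intro power_mono) (auto simp: less_imp_le)
    finally have bk: "b k \<le> h ^ k" .
    have mult: "b (i * k + l) \<le> h ^ (i * k) * b l" for i l
    proof (induction i)
      case (Suc i)
      have "b (Suc i * k + l) = b (k + (i * k + l))" by (simp add: algebra_simps)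
      also have "\<dots> \<le> b k * b (i * k + l)" by (rule sub)
      also have "\<dots> \<le> h ^ k * (h ^ (i * k) * b l)"
        using bk Suc bpos[of "i * k + l"] h1 by (intro mult_mono) auto
      finally show ?case by (simp add: power_add)
    qed simp
    define C where "C = Max (b ` {..<k})"
    have C: "b l \<le> C" if "l < k" for l using that by (simp add: C_def)
    have "0 < C" using C[of 0] k bpos[of 0] by simp
    moreover have "b n \<le> C * h ^ n" for n
    proof -
      have "b n = b ((n div k) * k + n mod k)" by simp
      also have "\<dots> \<le> h ^ ((n div k) * k) * b (n mod k)" by (rule mult)
      also have "\<dots> \<le> h ^ n * C"
        using h1 C[of "n mod k"] k bpos[of "n mod k"]
        by (intro mult_mono power_increasing) (auto simp: div_times_less_eq_dividend)
      finally show ?thesis by (simp add: mult.commute)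
    qed
    ultimately show ?thesis by (auto simp: h_def)
  qed
  show ?thesis using that g1 pow upper lower by blast
qed

lemma sum_norm_powi_less:
  fixes \<mu> :: complex
  assumes "finite D" "\<And>i. i \<in> D \<Longrightarrow> i < m" "2 \<le> norm \<mu>"
  shows "(\<Sum>i\<in>D. norm (\<mu> powi i)) < norm \<mu> powi m"
  using assms(1,2)
proof (induction D arbitrary: m rule: finite_linorder_max_induct)
  case empty
  have "0 < norm \<mu>" using assms(3) by linarith
  then show ?case by (simp only: sum.empty zero_less_power_int)
next
  case (insert M D)
  have "(\<Sum>i\<in>insert M D. norm (\<mu> powi i)) = norm \<mu> powi M + (\<Sum>i\<in>D. norm (\<mu> powi i))"
    using insert by (subst sum.insert) (auto simp: norm_power_int)
  also have "\<dots> < norm \<mu> powi M + norm \<mu> powi M"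
    using insert.IH[of M] insert.hyps by simp
  also have "\<dots> \<le> norm \<mu> * norm \<mu> powi M"
    using mult_right_mono[OF assms(3), of "norm \<mu> powi M"] by simp
  also have "\<dots> = norm \<mu> powi (1 + M)"
    using assms(3) by (subst power_int_add) auto
  also have "\<dots> \<le> norm \<mu> powi m"
    using insert.prems[of M] assms(3) by (intro power_int_increasing) auto
  finally show ?case .
qed

text \<open>
  The term of the largest exponent at which two such sums differ dominates all smaller ones
  together, because the modulus of the base is at least \<open>2\<close>.
\<close>

lemma sum_powi_inj:
  fixes \<mu> :: complex
  assumes "finite I" "finite J" "2 \<le> norm \<mu>" and eq: "(\<Sum>i\<in>I. \<mu> powi i) = (\<Sum>i\<in>J. \<mu> powi i)"
  shows "I = J"
proof (rule ccontr)
  define f where "f D = (\<Sum>i\<in>D. \<mu> powi i)" for D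
  assume "I \<noteq> J"
  let ?S = "(I - J) \<union> (J - I)"
  have fin: "finite ?S" using assms by auto
  have ne: "?S \<noteq> {}" using \<open>I \<noteq> J\<close> by auto
  define m where "m = Max ?S"
  have mS: "m \<in> ?S" unfolding m_def by (rule Max_in[OF fin ne])
  have le: "i \<le> m" if "i \<in> ?S" for i unfolding m_def by (rule Max_ge[OF fin that])
  have split: "f D = f (D - D') + f (D \<inter> D')" if "finite D" for D D'
    unfolding f_def using that sum.Int_Diff[of D _ D'] by (simp add: add.commute)
  have e: "f (I - J) = f (J - I)"
    using split[of I J] split[of J I] eq assms(1,2) by (simp add: f_def Int_commute)
  have aux: False if "finite X" "finite Z" "f X = f Z" "X \<inter> Z = {}" "m \<in> X" "\<forall>i\<in>X \<union> Z. i \<le> m" for X Z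
  proof -
    have "f X = \<mu> powi m + f (X - {m})" unfolding f_def using that by (simp add: sum.remove)
    then have "\<mu> powi m = f Z - f (X - {m})" using that by simp
    then have "norm (\<mu> powi m) \<le> norm (f Z) + norm (f (X - {m}))" by (metis norm_triangle_ineq4)
    also have "\<dots> \<le> (\<Sum>i\<in>Z. norm (\<mu> powi i)) + (\<Sum>i\<in>X - {m}. norm (\<mu> powi i))"
      unfolding f_def by (intro add_mono norm_sum)
    also have "\<dots> = (\<Sum>i\<in>Z \<union> (X - {m}). norm (\<mu> powi i))"
      using that by (subst sum.union_disjoint) auto
    also have "\<dots> < norm \<mu> powi m"
    proof (rule sum_norm_powi_less)
      show "i < m" if "i \<in> Z \<union> (X - {m})" for i
        using that \<open>X \<inter> Z = {}\<close> \<open>m \<in> X\<close> \<open>\<forall>i\<in>X \<union> Z. i \<le> m\<close> by (metis Diff_iff Un_iff disjoint_iff insertI1 order_le_less)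
    qed (use that assms in auto)
    finally show False by (simp add: norm_power_int)
  qed
  show False
  proof (cases "m \<in> I - J")
    case True
    then show False using aux[of "I - J" "J - I"] e le assms(1,2) by blast
  next
    case False
    then show False using aux[of "J - I" "I - J"] e le assms(1,2) mS by force
  qed
qed

text \<open>
  Fubini for counting, in the form needed for conditions that constrain one entry in terms of
  the others.
\<close>

lemma card_slices:
  assumes fin: "finite B" and i: "i \<le> s" and "0 \<le> M"
    and slice: "\<And>ys. ys \<in> tuples B s \<Longrightarrow>
      real (card {z \<in> B. take i ys @ z # drop i ys \<in> X}) \<le> M"
  shows "real (card (X \<inter> tuples B (Suc s))) \<le> M * real (card B) ^ s"
proof -
  let ?ins = "\<lambda>(ys, z). take i ys @ z # drop i ys"
  define P where "P = Sigma (tuples B s) (\<lambda>ys. {z \<in> B. take i ys @ z # drop i ys \<in> X})"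
  have ft: "finite (tuples B s)" and ct: "card (tuples B s) = card B ^ s"
    using finite_lists_length_eq[OF fin, of s] card_lists_length_eq[OF fin, of s]
    by (simp_all add: tuples_def conj_commute)
  have finP: "finite P" unfolding P_def using ft fin by auto
  have "X \<inter> tuples B (Suc s) \<subseteq> ?ins ` P"
  proof
    fix xs assume xs: "xs \<in> X \<inter> tuples B (Suc s)"
    define ys where "ys = take i xs @ drop (Suc i) xs"
    have len: "i < length xs" using xs i by (auto simp: tuples_def)
    have "take i ys @ xs ! i # drop i ys = xs"
      using len by (simp add: ys_def id_take_nth_drop[symmetric])
    moreover have "ys \<in> tuples B s"
      using xs i by (auto simp: ys_def tuples_def dest!: in_set_takeD in_set_dropD)
    moreover have "xs ! i \<in> B" using xs len by (auto simp: tuples_def)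
    ultimately show "xs \<in> ?ins ` P" using xs by (intro image_eqI[of _ _ "(ys, xs ! i)"]) (auto simp: P_def)
  qed
  then have "card (X \<inter> tuples B (Suc s)) \<le> card P"
    using finP by (meson card_image_le card_mono finite_imageI order_trans)
  then have "real (card (X \<inter> tuples B (Suc s))) \<le> real (card P)" by simp
  also have "real (card P) = (\<Sum>ys\<in>tuples B s. real (card {z \<in> B. take i ys @ z # drop i ys \<in> X}))"
    unfolding P_def using ft fin by (subst card_SigmaI) auto
  also have "\<dots> \<le> (\<Sum>ys\<in>tuples B s. M)" by (intro sum_mono slice)
  also have "\<dots> = M * real (card B) ^ s" by (simp add: ct)
  finally show ?thesis .
qed

text \<open>
  The linear factor \<open>n + 1\<close> is absorbed by passing from \<open>\<theta>\<close> to its square root.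
\<close>

lemma exp_negligible_if_ratio_bound:
  assumes sub: "A \<subseteq> tuples (carrier G) s" and "0 < \<theta>" "\<theta> < 1"
    and bound: "\<And>n. real (card (A \<inter> tuples (word_ball G Y n) s)) / real (card (word_ball G Y n)) ^ s
      \<le> C * (real n + 1) * \<theta> ^ n"
  shows "exp_negligible G Y s A"
proof -
  define \<eta> where "\<eta> = sqrt \<theta>"
  have \<eta>: "0 < \<eta>" "\<eta> < 1" "\<theta> = \<eta> * \<eta>" using assms by (simp_all add: \<eta>_def)
  have "(\<lambda>n. C * (real n * \<eta> ^ n + \<eta> ^ n)) \<longlonglongrightarrow> C * (0 + 0)"
    using \<eta> by (intro tendsto_intros powser_times_n_limit_0 LIMSEQ_power_zero) auto
  then have "\<forall>\<^sub>F n in sequentially. C * (real n * \<eta> ^ n + \<eta> ^ n) < 1"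
    by (rule order_tendstoD) simp
  then have "\<forall>\<^sub>F n in sequentially. ereal (root n (real (card (A \<inter> tuples (word_ball G Y n) s)) /
      real (card (word_ball G Y n)) ^ s)) \<le> ereal \<eta>"
    using eventually_gt_at_top[of 0]
  proof eventually_elim
    case (elim n)
    let ?q = "real (card (A \<inter> tuples (word_ball G Y n) s)) / real (card (word_ball G Y n)) ^ s"
    have "?q \<le> C * (real n + 1) * \<theta> ^ n" by (rule bound)
    also have "\<dots> = C * (real n * \<eta> ^ n + \<eta> ^ n) * \<eta> ^ n"
      by (simp add: \<eta>(3) power_mult_distrib algebra_simps)
    also have "\<dots> \<le> 1 * \<eta> ^ n" using elim \<eta> by (intro mult_right_mono) auto
    finally have "root n ?q \<le> root n (\<eta> ^ n)" using elim by simp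
    then show ?case using elim \<eta> by (simp add: real_root_power_cancel)
  qed
  then have "limsup (\<lambda>n. ereal (root n (real (card (A \<inter> tuples (word_ball G Y n) s)) /
      real (card (word_ball G Y n)) ^ s))) \<le> ereal \<eta>"
    by (rule Limsup_bounded)
  also have "\<dots> < 1" using \<eta> by simp
  finally show ?thesis using sub by (simp add: exp_negligible_def)
qed

section \<open>Balls of a finitely generated group\<close>

locale fin_gen_group = group G for G (structure) +
  fixes Y
  assumes fin_gen: "finite_generating_set G Y"
begin

definition letters where "letters = Y \<union> m_inv G ` Y"

abbreviation ball where "ball \<equiv> word_ball G Y"

lemma finite_letters: "finite letters"
  using fin_gen by (simp add: letters_def finite_generating_set_def)

lemma letters_closed: "letters \<subseteq> carrier G"
  using fin_gen by (auto simp: letters_def finite_generating_set_def)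

lemma inv_letters: "y \<in> letters \<Longrightarrow> inv y \<in> letters"
  using fin_gen by (auto simp: letters_def finite_generating_set_def subset_iff)

lemma foldr_mult_closed: "set ws \<subseteq> carrier G \<Longrightarrow> foldr (\<otimes>) ws \<one> \<in> carrier G"
  by (induction ws) auto

lemma foldr_mult_append:
  "set us \<subseteq> carrier G \<Longrightarrow> set vs \<subseteq> carrier G \<Longrightarrow>
    foldr (\<otimes>) (us @ vs) \<one> = foldr (\<otimes>) us \<one> \<otimes> foldr (\<otimes>) vs \<one>"
  by (induction us) (auto simp: m_assoc foldr_mult_closed simp del: foldr_append)

lemma ex_word: "g \<in> carrier G \<Longrightarrow> \<exists>ws. set ws \<subseteq> letters \<and> foldr (\<otimes>) ws \<one> = g"
proof -
  assume "g \<in> carrier G"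
  then have "g \<in> generate G Y" using fin_gen by (simp add: finite_generating_set_def)
  then show ?thesis
  proof induction
    case one
    then show ?case by (intro exI[of _ "[]"]) simp
  next
    case (incl h)
    then have "h \<in> letters" by (simp add: letters_def)
    then show ?case using letters_closed by (intro exI[of _ "[h]"]) auto
  next
    case (inv h)
    then have "inv h \<in> letters" by (simp add: letters_def)
    then show ?case using letters_closed by (intro exI[of _ "[inv h]"]) auto
  next
    case (eng h1 h2)
    then obtain us vs where "set us \<subseteq> letters" "foldr (\<otimes>) us \<one> = h1"
      "set vs \<subseteq> letters" "foldr (\<otimes>) vs \<one> = h2" by blast
    then show ?case using letters_closed
      by (intro exI[of _ "us @ vs"]) (auto simp: foldr_mult_append simp del: foldr_append)
  qed
qed

lemma ball_iff:
  "g \<in> ball n \<longleftrightarrow> (\<exists>ws. length ws \<le> n \<and> set ws \<subseteq> letters \<and> foldr (\<otimes>) ws \<one> = g)"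
proof -
  let ?P = "\<lambda>g m. \<exists>ws. length ws = m \<and> set ws \<subseteq> letters \<and> foldr (\<otimes>) ws \<one> = g"
  have wl: "word_length G Y g = (LEAST m. ?P g m)" by (simp add: word_length_def letters_def)
  show ?thesis
  proof
    assume g: "g \<in> ball n"
    then have "\<exists>m. ?P g m" using ex_word by (auto simp: word_ball_def)
    then have "?P g (word_length G Y g)" unfolding wl by (rule LeastI_ex)
    then show "\<exists>ws. length ws \<le> n \<and> set ws \<subseteq> letters \<and> foldr (\<otimes>) ws \<one> = g"
      using g unfolding word_ball_def by (metis (lifting) mem_Collect_eq)
  next
    assume "\<exists>ws. length ws \<le> n \<and> set ws \<subseteq> letters \<and> foldr (\<otimes>) ws \<one> = g"
    then obtain ws where ws: "length ws \<le> n" "set ws \<subseteq> letters" "foldr (\<otimes>) ws \<one> = g" by blast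
    have "word_length G Y g \<le> length ws" unfolding wl by (rule Least_le) (use ws in blast)
    moreover have "g \<in> carrier G" using foldr_mult_closed[of ws] ws letters_closed by auto
    ultimately show "g \<in> ball n" using ws by (simp add: word_ball_def)
  qed
qed

lemma ball_closed: "g \<in> ball n \<Longrightarrow> g \<in> carrier G"
  by (simp add: word_ball_def)

lemma ball_0: "ball 0 = {\<one>}"
  by (auto simp: ball_iff)

lemma ball_mono: "m \<le> n \<Longrightarrow> ball m \<subseteq> ball n"
  by (auto simp: word_ball_def)

lemma one_in_ball: "\<one> \<in> ball n"
  using ball_0 ball_mono[of 0 n] by auto

lemma letter_in_ball: "y \<in> letters \<Longrightarrow> y \<in> ball 1"
  using letters_closed unfolding ball_iff by (intro exI[of _ "[y]"]) auto

lemma ball_mult: "g \<in> ball m \<Longrightarrow> h \<in> ball n \<Longrightarrow> g \<otimes> h \<in> ball (m + n)"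
proof -
  assume "g \<in> ball m" "h \<in> ball n"
  then obtain us vs where "length us \<le> m" "set us \<subseteq> letters" "foldr (\<otimes>) us \<one> = g"
      "length vs \<le> n" "set vs \<subseteq> letters" "foldr (\<otimes>) vs \<one> = h" unfolding ball_iff by blast
  then show ?thesis using letters_closed unfolding ball_iff
    by (intro exI[of _ "us @ vs"]) (auto simp: foldr_mult_append simp del: foldr_append)
qed

lemma ball_mult_le: "g \<in> ball m \<Longrightarrow> h \<in> ball n \<Longrightarrow> m + n \<le> k \<Longrightarrow> g \<otimes> h \<in> ball k"
  using ball_mult ball_mono by blast

lemma ball_SucE:
  assumes "g \<in> ball (Suc n)"
  obtains h y where "h \<in> ball n" "y \<in> insert \<one> letters" "g = h \<otimes> y"
proof -
  obtain ws where ws: "length ws \<le> Suc n" "set ws \<subseteq> letters" "foldr (\<otimes>) ws \<one> = g"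
    using assms unfolding ball_iff by blast
  show ?thesis
  proof (cases ws rule: rev_cases)
    case Nil
    then show ?thesis using that[OF one_in_ball, of \<one>] ws by auto
  next
    case (snoc us y)
    have "foldr (\<otimes>) us \<one> \<in> ball n" using snoc ws unfolding ball_iff by (intro exI[of _ us]) auto
    moreover have "g = foldr (\<otimes>) us \<one> \<otimes> y"
      using snoc ws letters_closed foldr_mult_append[of us "[y]"] by (auto simp del: foldr_append)
    ultimately show ?thesis using that[of "foldr (\<otimes>) us \<one>" y] snoc ws by auto
  qed
qed

lemma ball_inv: "g \<in> ball n \<Longrightarrow> inv g \<in> ball n"
proof (induction n arbitrary: g)
  case 0
  then show ?case by (simp add: ball_0)
next
  case (Suc n)
  then obtain h y where hy: "h \<in> ball n" "y \<in> insert \<one> letters" "g = h \<otimes> y" by (elim ball_SucE)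
  have y: "y \<in> carrier G" "inv y \<in> ball 1"
    using hy(2) letters_closed inv_letters letter_in_ball one_in_ball by auto
  have "inv g = inv y \<otimes> inv h" using hy y ball_closed by (simp add: inv_mult_group)
  then show ?case using ball_mult[OF y(2) Suc.IH[OF hy(1)]] by simp
qed

lemma finite_ball: "finite (ball n)"
proof (induction n)
  case (Suc n)
  have "ball (Suc n) \<subseteq> (\<lambda>(h, y). h \<otimes> y) ` (ball n \<times> insert \<one> letters)"
    by (auto elim!: ball_SucE)
  then show ?case using Suc finite_letters by (meson finite.insertI finite_SigmaI finite_imageI finite_subset)
qed (simp add: ball_0)

lemma ex_ball: "g \<in> carrier G \<Longrightarrow> \<exists>n. g \<in> ball n"
  by (auto simp: word_ball_def)

lemma ball_pow: "g \<in> ball n \<Longrightarrow> g [^] (k::nat) \<in> ball (n * k)"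
  by (induction k) (auto simp: one_in_ball intro: ball_mult_le)

lemma card_ball_add: "card (ball (m + n)) \<le> card (ball m) * card (ball n)"
proof -
  have "ball (m + n) \<subseteq> (\<lambda>(g, h). g \<otimes> h) ` (ball m \<times> ball n)"
  proof
    fix g assume "g \<in> ball (m + n)"
    then obtain ws where ws: "length ws \<le> m + n" "set ws \<subseteq> letters" "foldr (\<otimes>) ws \<one> = g"
      unfolding ball_iff by blast
    have s: "set (take m ws) \<subseteq> letters" "set (drop m ws) \<subseteq> letters"
      using ws by (auto dest: in_set_takeD in_set_dropD)
    have "g = foldr (\<otimes>) (take m ws) \<one> \<otimes> foldr (\<otimes>) (drop m ws) \<one>"
      using ws foldr_mult_append[of "take m ws" "drop m ws"] s letters_closed
      by (simp del: foldr_append)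
    moreover have "foldr (\<otimes>) (take m ws) \<one> \<in> ball m"
      unfolding ball_iff using s by (intro exI[of _ "take m ws"]) auto
    moreover have "foldr (\<otimes>) (drop m ws) \<one> \<in> ball n"
      unfolding ball_iff using s ws by (intro exI[of _ "drop m ws"]) auto
    ultimately show "g \<in> (\<lambda>(g, h). g \<otimes> h) ` (ball m \<times> ball n)" by blast
  qed
  then have "card (ball (m + n)) \<le> card (ball m \<times> ball n)"
    using finite_ball by (meson card_image_le card_mono finite_SigmaI finite_imageI order_trans)
  then show ?thesis by (simp add: card_cartesian_product)
qed

lemma card_ball_pos: "1 \<le> card (ball n)"
  using one_in_ball[of n] finite_ball[of n] by (metis One_nat_def Suc_leI card_gt_0_iff empty_iff)

end

text \<open>
  A product of commuting letters depends only on their multiplicities, and the number of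
  multiplicity functions of total \<open>n\<close> on \<open>k\<close> letters is the coefficient of \<open>z ^ n\<close> in
  \<open>1 / (1 - z) ^ k\<close>.  A single term of a series with nonnegative terms is at most its sum.
  Keeping \<open>z\<close> free lets it be taken close to \<open>1\<close> when \<open>k\<close> is small compared with \<open>n\<close>.
\<close>

lemma (in group) card_products_commuting:
  fixes z :: real
  assumes "finite E" "E \<subseteq> carrier G" "\<And>x y. x \<in> E \<Longrightarrow> y \<in> E \<Longrightarrow> x \<otimes> y = y \<otimes> x"
    and z: "0 < z" "z < 1"
  shows "finite {foldr (\<otimes>) ws \<one> | ws. length ws = n \<and> set ws \<subseteq> E} \<and>
    real (card {foldr (\<otimes>) ws \<one> | ws. length ws = n \<and> set ws \<subseteq> E}) * z ^ n * (1 - z) ^ card E \<le> 1"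
  using assms(1-3)
proof (induction E arbitrary: n rule: finite_induct)
  case empty
  have "{foldr (\<otimes>) ws \<one> | ws. length ws = n \<and> set ws \<subseteq> {}} \<subseteq> {\<one>}" by auto
  then have "finite {foldr (\<otimes>) ws \<one> | ws. length ws = n \<and> set ws \<subseteq> {}}"
    "card {foldr (\<otimes>) ws \<one> | ws. length ws = n \<and> set ws \<subseteq> {}} \<le> 1"
    by (auto intro: finite_subset dest: card_mono[rotated])
  moreover have "z ^ n \<le> 1" using z by (intro power_le_one) auto
  ultimately show ?case using z by (auto intro!: mult_le_one)
next
  case (insert e E)
  define P where "P E n = {foldr (\<otimes>) ws \<one> | ws. length ws = n \<and> set ws \<subseteq> E}" for E n
  have IH: "finite (P E n)" "real (card (P E n)) * z ^ n * (1 - z) ^ card E \<le> 1" for n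
    unfolding P_def using insert.IH[of n] insert.prems by auto
  have e: "e \<in> carrier G" using insert by auto
  have Pc: "b \<in> carrier G" if "b \<in> P E n" for b n
  proof -
    have "set ws \<subseteq> carrier G \<Longrightarrow> foldr (\<otimes>) ws \<one> \<in> carrier G" for ws by (induction ws) auto
    then show ?thesis using that insert.prems by (auto simp: P_def)
  qed
  \<comment> \<open>Collect the occurrences of \<open>e\<close> in front.\<close>
  have sub: "P (insert e E) n \<subseteq> (\<Union>c\<le>n. (\<lambda>b. e [^] c \<otimes> b) ` P E (n - c))"
  proof -
    have "\<exists>c\<le>length ws. \<exists>b\<in>P E (length ws - c). foldr (\<otimes>) ws \<one> = e [^] c \<otimes> b"
      if "set ws \<subseteq> insert e E" for ws
      using that
    proof (induction ws)
      case Nil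
      then show ?case by (auto simp: P_def)
    next
      case (Cons f ws)
      then obtain c b where cb: "c \<le> length ws" "b \<in> P E (length ws - c)"
        "foldr (\<otimes>) ws \<one> = e [^] c \<otimes> b" by auto
      show ?case
      proof (cases "f = e")
        case True
        have "foldr (\<otimes>) (f # ws) \<one> = e [^] Suc c \<otimes> b"
          using cb e Pc[OF cb(2)] True nat_pow_Suc2[OF e, of c] by (simp add: m_assoc del: nat_pow_Suc)
        then show ?thesis using cb by (intro exI[of _ "Suc c"]) auto
      next
        case False
        then have f: "f \<in> E" using Cons by auto
        then have fc: "f \<in> carrier G" "f \<otimes> e = e \<otimes> f" using insert.prems by auto
        have "f \<otimes> e [^] c = e [^] c \<otimes> f"
        proof (induction c)
          case (Suc c)
          then show ?case using fc e by (simp add: m_assoc[symmetric]) (simp add: m_assoc)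
        qed (use fc in simp)
        then have "foldr (\<otimes>) (f # ws) \<one> = e [^] c \<otimes> (f \<otimes> b)"
          using cb e fc Pc[OF cb(2)] by (simp add: m_assoc[symmetric])
        moreover have "f \<otimes> b \<in> P E (length (f # ws) - c)"
        proof -
          obtain vs where "length vs = length ws - c" "set vs \<subseteq> E" "b = foldr (\<otimes>) vs \<one>"
            using cb(2) by (auto simp: P_def)
          then show ?thesis unfolding P_def using f cb(1) by (intro CollectI exI[of _ "f # vs"]) auto
        qed
        ultimately show ?thesis using cb by (intro exI[of _ c]) auto
      qed
    qed
    then show ?thesis unfolding P_def by fastforce
  qed
  have fin: "finite (\<Union>c\<le>n. (\<lambda>b. e [^] c \<otimes> b) ` P E (n - c))" using IH by auto
  have q: "0 \<le> z ^ n * (1 - z) ^ card (insert e E)" using z by simp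
  have "card (P (insert e E) n) \<le> (\<Sum>c\<le>n. card ((\<lambda>b. e [^] c \<otimes> b) ` P E (n - c)))"
    using card_mono[OF fin sub] card_UN_le[of "{..n}" "\<lambda>c. (\<lambda>b. e [^] c \<otimes> b) ` P E (n - c)"]
    by (meson finite_atMost order_trans)
  also have "\<dots> \<le> (\<Sum>c\<le>n. card (P E (n - c)))" by (intro sum_mono card_image_le IH)
  finally have "real (card (P (insert e E) n)) \<le> (\<Sum>c\<le>n. real (card (P E (n - c))))"
    by (metis of_nat_le_iff of_nat_sum)
  then have "real (card (P (insert e E) n)) * (z ^ n * (1 - z) ^ card (insert e E))
      \<le> (\<Sum>c\<le>n. real (card (P E (n - c)))) * (z ^ n * (1 - z) ^ card (insert e E))"
    using q by (rule mult_right_mono)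
  also have "\<dots> = (\<Sum>c\<le>n. (real (card (P E (n - c))) * z ^ (n - c) * (1 - z) ^ card E) * (z ^ c * (1 - z)))"
    unfolding sum_distrib_right
  proof (rule sum.cong[OF HOL.refl])
    fix c assume "c \<in> {..n}"
    then have "z ^ n = z ^ (n - c) * z ^ c" by (simp flip: power_add)
    then show "real (card (P E (n - c))) * (z ^ n * (1 - z) ^ card (insert e E)) =
        real (card (P E (n - c))) * z ^ (n - c) * (1 - z) ^ card E * (z ^ c * (1 - z))"
      using insert.hyps by simp
  qed
  also have "\<dots> \<le> (\<Sum>c\<le>n. 1 * (z ^ c * (1 - z)))"
    using z by (intro sum_mono mult_right_mono IH) auto
  also have "\<dots> = 1 - z ^ Suc n"
    using z by (simp add: sum_distrib_right[symmetric] sum_gp0)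
  also have "\<dots> \<le> 1" using z by simp
  finally show ?case using finite_subset[OF sub fin] unfolding P_def by (simp add: mult.assoc)
qed

section \<open>Groups acting by affine maps of the complex line\<close>

text \<open>The heights that a path from height \<open>0\<close> to height \<open>k\<close> has to pass.\<close>

abbreviation on_way :: "int \<Rightarrow> int \<Rightarrow> bool" where
  "on_way h k \<equiv> 0 \<le> h \<and> h \<le> k \<or> k \<le> h \<and> h \<le> 0"

text \<open>
  The two equations say that \<open>x\<close> acting by \<open>z \<mapsto> \<mu> ^ \<kappa> x * z + \<beta> x\<close> is an action on the complex line.
  It need not be faithful, so commutativity of the kernel of \<open>\<kappa>\<close> has to be asked for.
\<close>

locale height_group = fin_gen_group +
  fixes \<kappa> :: "'a \<Rightarrow> int" and \<beta> :: "'a \<Rightarrow> complex" and \<mu> :: complex and t a :: 'a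
  assumes height_mult: "x \<in> carrier G \<Longrightarrow> y \<in> carrier G \<Longrightarrow> \<kappa> (x \<otimes> y) = \<kappa> x + \<kappa> y"
    and trans_mult: "x \<in> carrier G \<Longrightarrow> y \<in> carrier G \<Longrightarrow> \<beta> (x \<otimes> y) = \<beta> x + \<mu> powi \<kappa> x * \<beta> y"
    and norm_mu: "1 < norm \<mu>"
    and kernel_comm: "x \<in> carrier G \<Longrightarrow> y \<in> carrier G \<Longrightarrow> \<kappa> x = 0 \<Longrightarrow> \<kappa> y = 0 \<Longrightarrow> x \<otimes> y = y \<otimes> x"
    and t_closed: "t \<in> carrier G" and height_t: "\<kappa> t = 1"
    and a_closed: "a \<in> carrier G" and height_a: "\<kappa> a = 0" and trans_a: "\<beta> a \<noteq> 0"
begin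

lemma mu_nonzero: "\<mu> \<noteq> 0"
  using norm_mu by auto

lemma powi_mu_eq_1: "\<mu> powi k = 1 \<longleftrightarrow> k = 0"
proof
  assume "\<mu> powi k = 1"
  then have e: "norm \<mu> powi k = norm \<mu> powi 0" by (simp flip: norm_power_int)
  show "k = 0"
  proof (rule ccontr)
    assume "k \<noteq> 0"
    then consider "k < 0" | "0 < k" by linarith
    then show False
      using power_int_strict_increasing[of k 0 "norm \<mu>"] power_int_strict_increasing[of 0 k "norm \<mu>"]
        norm_mu e by cases auto
  qed
qed simp

lemma height_one [simp]: "\<kappa> \<one> = 0"
  using height_mult[of \<one> \<one>] by simp

lemma height_inv: "x \<in> carrier G \<Longrightarrow> \<kappa> (inv x) = - \<kappa> x"
  using height_mult[of x "inv x"] by simp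

lemma trans_one [simp]: "\<beta> \<one> = 0"
  using trans_mult[of \<one> \<one>] by simp

lemma trans_inv:
  assumes "x \<in> carrier G"
  shows "\<beta> (inv x) = - (\<mu> powi (- \<kappa> x) * \<beta> x)"
proof -
  have "\<beta> (inv x) + \<mu> powi (- \<kappa> x) * \<beta> x = 0"
    using trans_mult[of "inv x" x] assms by (simp add: height_inv)
  then show ?thesis by (simp only: eq_neg_iff_add_eq_0)
qed

lemma height_pow_t [simp]: "\<kappa> (t [^] (i::int)) = i"
proof -
  have nat: "\<kappa> (t [^] (k::nat)) = int k" for k
    by (induction k) (auto simp: height_mult t_closed height_t)
  show ?thesis
    by (cases i rule: int_cases2) (auto simp: int_pow_int int_pow_neg_int t_closed height_inv nat)
qed

lemma pow_t_closed [simp]: "t [^] (i::int) \<in> carrier G"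
  by (simp add: t_closed)

lemma trans_conj:
  assumes "g \<in> carrier G" "x \<in> carrier G" "\<kappa> x = 0"
  shows "\<beta> (g \<otimes> x \<otimes> inv g) = \<mu> powi \<kappa> g * \<beta> x"
proof -
  have "\<mu> powi \<kappa> g * \<mu> powi (- \<kappa> g) = 1"
    using mu_nonzero by (simp add: power_int_minus)
  then show ?thesis
    using assms by (simp add: trans_mult trans_inv height_mult mult.assoc[symmetric])
qed

lemma height_conj:
  "g \<in> carrier G \<Longrightarrow> x \<in> carrier G \<Longrightarrow> \<kappa> (g \<otimes> x \<otimes> inv g) = \<kappa> x"
  by (simp add: height_mult height_inv)

text \<open>
  Elements of the same height differ by an element of the kernel of \<open>\<kappa>\<close>, which commutes with \<open>x\<close>.
\<close>

lemma conj_eq_if_same_height: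
  assumes "g \<in> carrier G" "h \<in> carrier G" "\<kappa> g = \<kappa> h" "x \<in> carrier G" "\<kappa> x = 0"
  shows "g \<otimes> x \<otimes> inv g = h \<otimes> x \<otimes> inv h"
proof -
  let ?d = "inv h \<otimes> g"
  have d: "?d \<in> carrier G" "\<kappa> ?d = 0" using assms by (auto simp: height_mult height_inv)
  have g: "g = h \<otimes> ?d" using assms by (simp add: m_assoc[symmetric])
  have "g \<otimes> x \<otimes> inv g = h \<otimes> (?d \<otimes> x) \<otimes> inv g"
    using assms d by (subst g) (simp only: m_assoc m_closed inv_closed)
  also have "?d \<otimes> x = x \<otimes> ?d" by (rule kernel_comm) (use assms d in auto)
  also have "h \<otimes> (x \<otimes> ?d) \<otimes> inv g = h \<otimes> x \<otimes> inv h"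
    using assms by (simp add: m_assoc)
  finally show ?thesis .
qed

section \<open>Iterated commutators\<close>

lemma group_comm_closed: "x \<in> carrier G \<Longrightarrow> y \<in> carrier G \<Longrightarrow> group_comm G x y \<in> carrier G"
  by (simp add: group_comm_def)

lemma height_comm: "x \<in> carrier G \<Longrightarrow> y \<in> carrier G \<Longrightarrow> \<kappa> (group_comm G x y) = 0"
  by (simp add: group_comm_def height_mult height_inv)

lemma trans_comm_translation:
  assumes "v \<in> carrier G" "x \<in> carrier G" "\<kappa> v = 0"
  shows "\<beta> (group_comm G v x) = (\<mu> powi (- \<kappa> x) - 1) * \<beta> v"
  using assms
  by (simp add: group_comm_def trans_mult height_mult height_inv trans_inv algebra_simps)

lemma trans_foldl_comm_nonzero:
  assumes "v \<in> carrier G" "\<kappa> v = 0" "\<beta> v \<noteq> 0"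
    and "\<And>x. x \<in> set zs \<Longrightarrow> x \<in> carrier G \<and> \<kappa> x \<noteq> 0"
  shows "\<beta> (foldl (group_comm G) v zs) \<noteq> 0"
  using assms
proof (induction zs arbitrary: v)
  case (Cons x zs)
  have x: "x \<in> carrier G" "\<kappa> x \<noteq> 0" using Cons.prems(4)[of x] by auto
  have "\<mu> powi (- \<kappa> x) \<noteq> 1" using x powi_mu_eq_1[of "- \<kappa> x"] by simp
  then have "\<beta> (group_comm G v x) \<noteq> 0"
    using trans_comm_translation[of v x] Cons.prems x by simp
  then have "\<beta> (foldl (group_comm G) (group_comm G v x) zs) \<noteq> 0"
    using Cons.prems x by (intro Cons.IH) (auto simp: height_comm group_comm_closed)
  then show ?case by simp
qed simp

text \<open>
  Commuting affine maps share their fixed points: if \<open>\<kappa> y \<noteq> 0\<close>, then \<open>x\<close> fixes the fixed point of \<open>y\<close>,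
  and the equation can be solved for \<open>\<beta> x\<close> in terms of \<open>\<kappa> x\<close>.
\<close>

lemma trans_determined_by_height_if_commuting:
  assumes "x \<in> carrier G" "y \<in> carrier G" "\<beta> (group_comm G x y) = 0"
  shows "\<beta> x * (1 - \<mu> powi \<kappa> y) = \<beta> y * (1 - \<mu> powi \<kappa> x)"
proof -
  have "x \<otimes> y = y \<otimes> x \<otimes> group_comm G x y"
    using assms unfolding group_comm_def
    by (simp add: m_assoc[symmetric]) (simp add: m_assoc)
  then have "\<beta> (x \<otimes> y) = \<beta> (y \<otimes> x)"
    using assms by (simp add: trans_mult[of "y \<otimes> x"] group_comm_closed)
  then show ?thesis using assms by (simp add: trans_mult algebra_simps)
qed

section \<open>Inserting translations into words\<close>

definition step_bound :: int where
  "step_bound = Max ((\<lambda>y. \<bar>\<kappa> y\<bar>) ` insert \<one> letters)"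

lemma step_bound: "y \<in> insert \<one> letters \<Longrightarrow> \<bar>\<kappa> y\<bar> \<le> step_bound"
  unfolding step_bound_def using finite_letters by (intro Max_ge) auto

lemma step_bound_nonneg: "0 \<le> step_bound"
  using step_bound[of \<one>] by simp

text \<open>
  A discrete intermediate value theorem for the heights of the prefixes of a word.
\<close>

lemma prefix_near_height:
  assumes "x \<in> ball n" "on_way h (\<kappa> x)"
  shows "\<exists>p r m l. x = p \<otimes> r \<and> p \<in> ball m \<and> r \<in> ball l \<and> m + l \<le> n \<and> \<bar>\<kappa> p - h\<bar> \<le> step_bound"
  using assms
proof (induction n arbitrary: x)
  case 0
  then show ?case using step_bound_nonneg
    by (intro exI[of _ \<one>] exI[of _ 0]) (auto simp: ball_0)
next
  case (Suc n)
  show ?case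
  proof (cases "\<bar>\<kappa> x - h\<bar> \<le> step_bound")
    case True
    then show ?thesis using Suc.prems one_in_ball[of 0]
      by (intro exI[of _ x] exI[of _ \<one>] exI[of _ "Suc n"] exI[of _ 0]) (auto simp: ball_closed)
  next
    case False
    obtain x' y where xy: "x' \<in> ball n" "y \<in> insert \<one> letters" "x = x' \<otimes> y"
      using Suc.prems(1) by (elim ball_SucE)
    have c: "x' \<in> carrier G" "y \<in> carrier G" "y \<in> ball 1"
      using xy letters_closed ball_closed letter_in_ball one_in_ball by auto
    have "\<kappa> x = \<kappa> x' + \<kappa> y" "\<bar>\<kappa> y\<bar> \<le> step_bound"
      using xy c height_mult step_bound by auto
    then have "0 \<le> h \<and> h \<le> \<kappa> x' \<or> \<kappa> x' \<le> h \<and> h \<le> 0" using False Suc.prems(2) by linarith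
    then obtain p r m l where *: "x' = p \<otimes> r" "p \<in> ball m" "r \<in> ball l" "m + l \<le> n"
      "\<bar>\<kappa> p - h\<bar> \<le> step_bound" using Suc.IH[OF xy(1)] by blast
    have "x = p \<otimes> (r \<otimes> y)" using * c xy ball_closed by (simp add: m_assoc)
    moreover have "r \<otimes> y \<in> ball (l + 1)" using * c by (intro ball_mult)
    ultimately show ?thesis using * by (intro exI[of _ p] exI[of _ "r \<otimes> y"] exI[of _ m] exI[of _ "l + 1"]) auto
  qed
qed

definition bump :: "int \<Rightarrow> 'a" where
  "bump h = t [^] h \<otimes> a \<otimes> inv (t [^] h)"

lemma bump_closed: "bump h \<in> carrier G"
  by (simp add: bump_def a_closed)

lemma height_bump: "\<kappa> (bump h) = 0"
  by (simp add: bump_def height_conj a_closed height_a)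

lemma trans_bump: "\<beta> (bump h) = \<mu> powi h * \<beta> a"
  by (simp add: bump_def trans_conj a_closed height_a)

lemma ex_bump_cost: "\<exists>c. \<forall>h. \<bar>h\<bar> \<le> step_bound \<longrightarrow> bump h \<in> ball c"
proof -
  obtain n where n: "\<And>h. bump h \<in> ball (n h)" using ex_ball[OF bump_closed] by metis
  let ?S = "{- step_bound..step_bound}"
  have "bump h \<in> ball (Max (n ` ?S))" if "\<bar>h\<bar> \<le> step_bound" for h
  proof -
    have "n h \<le> Max (n ` ?S)" using that by (intro Max_ge) (auto intro!: imageI)
    then show ?thesis using n[of h] ball_mono by blast
  qed
  then show ?thesis by blast
qed

definition bump_cost :: nat where
  "bump_cost = (SOME c. \<forall>h. \<bar>h\<bar> \<le> step_bound \<longrightarrow> bump h \<in> ball c)"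

lemma bump_in_ball: "\<bar>h\<bar> \<le> step_bound \<Longrightarrow> bump h \<in> ball bump_cost"
  using someI_ex[OF ex_bump_cost] unfolding bump_cost_def by blast

text \<open>
  Near height \<open>h\<close> the translation \<open>bump h\<close> is cheap: if \<open>p\<close> is a prefix of \<open>x\<close> of height close to \<open>h\<close>, then
  conjugating \<open>bump h\<close> by \<open>inv p\<close> gives a bump at height \<open>h - \<kappa> p\<close>, which has bounded length.
  Inserting that element after \<open>p\<close> has the effect of multiplying \<open>x\<close> by \<open>bump h\<close> on the left.
\<close>

lemma bump_mult_in_ball:
  assumes "x \<in> ball n" "on_way h (\<kappa> x)"
  shows "bump h \<otimes> x \<in> ball (n + bump_cost)"
proof -
  obtain p r m l where *: "x = p \<otimes> r" "p \<in> ball m" "r \<in> ball l" "m + l \<le> n"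
    "\<bar>\<kappa> p - h\<bar> \<le> step_bound" using prefix_near_height[OF assms] by blast
  have c: "p \<in> carrier G" "r \<in> carrier G" using * ball_closed by auto
  let ?d = "bump (h - \<kappa> p)"
  have "bump h = (p \<otimes> t [^] (h - \<kappa> p)) \<otimes> a \<otimes> inv (p \<otimes> t [^] (h - \<kappa> p))"
    unfolding bump_def
    by (rule conj_eq_if_same_height) (use c in \<open>auto simp: height_mult a_closed height_a\<close>)
  also have "\<dots> = p \<otimes> ?d \<otimes> inv p"
    using c a_closed by (simp add: bump_def inv_mult_group m_assoc)
  finally have "bump h \<otimes> x = (p \<otimes> ?d) \<otimes> r"
    using c bump_closed by (simp add: *(1) m_assoc) (simp add: m_assoc[symmetric])
  moreover have "?d \<in> ball bump_cost" using * by (intro bump_in_ball) linarith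
  then have "(p \<otimes> ?d) \<otimes> r \<in> ball (m + bump_cost + l)" using * by (intro ball_mult)
  ultimately show ?thesis using * ball_mono[of "m + bump_cost + l" "n + bump_cost"] by auto
qed

text \<open>Spacing the inserted heights by \<open>K\<close> makes the base \<open>\<mu> ^ K\<close> large enough for unique expansions.\<close>

definition gap :: nat where
  "gap = (SOME K. 2 \<le> norm \<mu> ^ K \<and> 0 < K)"

lemma gap: "2 \<le> norm (\<mu> ^ gap)" "0 < gap"
proof -
  obtain K where K: "2 < norm \<mu> ^ K" using real_arch_pow[OF norm_mu] by blast
  then have "0 < K" by (cases K) auto
  with K have "\<exists>K. 2 \<le> norm \<mu> ^ K \<and> 0 < K" by (meson less_imp_le)
  from someI_ex[OF this] show "2 \<le> norm (\<mu> ^ gap)" "0 < gap"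
    unfolding gap_def by (simp_all add: norm_power)
qed

text \<open>
  A product of bumps at the heights \<open>gap * i\<close>.  Bumps do not change the height of the element they
  are multiplied with, so the cost estimate applies to each factor in turn.
\<close>

lemma ex_bumps:
  assumes "finite I"
  shows "\<exists>x. x \<in> carrier G \<and> \<kappa> x = 0 \<and> \<beta> x = (\<Sum>i\<in>I. (\<mu> ^ gap) powi i) * \<beta> a \<and>
    (\<forall>y n. y \<in> ball n \<longrightarrow> (\<forall>i\<in>I. on_way (int gap * i) (\<kappa> y))
      \<longrightarrow> x \<otimes> y \<in> ball (n + bump_cost * card I))"
  using assms
proof (induction I)
  case empty
  then show ?case by (intro exI[of _ \<one>]) (auto simp: ball_closed)
next
  case (insert j I)
  then obtain x where x: "x \<in> carrier G" "\<kappa> x = 0" "\<beta> x = (\<Sum>i\<in>I. (\<mu> ^ gap) powi i) * \<beta> a"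
    and len: "\<And>y n. y \<in> ball n \<Longrightarrow> (\<forall>i\<in>I. on_way (int gap * i) (\<kappa> y))
      \<Longrightarrow> x \<otimes> y \<in> ball (n + bump_cost * card I)" by blast
  let ?x = "bump (int gap * j) \<otimes> x"
  have "\<beta> ?x = (\<Sum>i\<in>insert j I. (\<mu> ^ gap) powi i) * \<beta> a"
    using insert.hyps x by (simp add: trans_mult bump_closed height_bump trans_bump power_int_power algebra_simps)
  moreover have "?x \<otimes> y \<in> ball (n + bump_cost * card (insert j I))"
    if y: "y \<in> ball n" and h: "\<forall>i\<in>insert j I. on_way (int gap * i) (\<kappa> y)" for y n
  proof -
    have xy: "x \<otimes> y \<in> ball (n + bump_cost * card I)" using y h by (intro len) auto
    have yc: "y \<in> carrier G" using y ball_closed by auto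
    have "bump (int gap * j) \<otimes> (x \<otimes> y) \<in> ball (n + bump_cost * card I + bump_cost)"
      using h by (intro bump_mult_in_ball[OF xy]) (simp add: height_mult x yc)
    then show ?thesis using insert.hyps x yc bump_closed by (simp add: m_assoc algebra_simps)
  qed
  ultimately show ?case using x bump_closed height_bump
    by (intro exI[of _ ?x]) (auto simp: height_mult)
qed

text \<open>
  The element \<open>\<alpha>\<^sub>I\<close>: a choice of a product of the bumps at the heights \<open>gap * i\<close> for \<open>i \<in> I\<close>.
\<close>

definition bumps :: "int set \<Rightarrow> 'a" where
  "bumps I = (SOME x. x \<in> carrier G \<and> \<kappa> x = 0 \<and> \<beta> x = (\<Sum>i\<in>I. (\<mu> ^ gap) powi i) * \<beta> a \<and>
    (\<forall>y n. y \<in> ball n \<longrightarrow> (\<forall>i\<in>I. on_way (int gap * i) (\<kappa> y))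
      \<longrightarrow> x \<otimes> y \<in> ball (n + bump_cost * card I)))"

lemma
  assumes "finite I"
  shows bumps_closed: "bumps I \<in> carrier G"
    and height_bumps: "\<kappa> (bumps I) = 0"
    and trans_bumps: "\<beta> (bumps I) = (\<Sum>i\<in>I. (\<mu> ^ gap) powi i) * \<beta> a"
    and bumps_mult_in_ball: "y \<in> ball n \<Longrightarrow>
      (\<And>i. i \<in> I \<Longrightarrow> on_way (int gap * i) (\<kappa> y)) \<Longrightarrow>
      bumps I \<otimes> y \<in> ball (n + bump_cost * card I)"
  using someI_ex[OF ex_bumps[OF assms]] unfolding bumps_def by blast+

lemma bumps_inj: "finite I \<Longrightarrow> finite J \<Longrightarrow> \<beta> (bumps I) = \<beta> (bumps J) \<Longrightarrow> I = J"
  using sum_powi_inj[OF _ _ gap(1)] trans_a by (simp add: trans_bumps)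

section \<open>Words that stay near height zero\<close>

text \<open>
  The letter \<open>\<one>\<close> serves as padding, so that shorter words are covered as well.
\<close>

primrec low :: "nat \<Rightarrow> nat \<Rightarrow> 'a set" where
  "low H 0 = {\<one>}"
| "low H (Suc n) = {x \<otimes> y | x y. x \<in> low H n \<and> y \<in> insert \<one> letters \<and> \<bar>\<kappa> (x \<otimes> y)\<bar> \<le> int H}"

text \<open>
  The contribution of the letter \<open>y\<close> read at height \<open>h\<close>, transported to an element of the kernel of \<open>\<kappa>\<close>.
\<close>

definition slots :: "nat \<Rightarrow> 'a set" where
  "slots H = (\<lambda>(h, y). t [^] h \<otimes> y \<otimes> inv (t [^] (h + \<kappa> y))) ` ({- int H..int H} \<times> insert \<one> letters)"

lemma letter_closed: "y \<in> insert \<one> letters \<Longrightarrow> y \<in> carrier G"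
  using letters_closed by auto

lemma slots_kernel: "x \<in> slots H \<Longrightarrow> x \<in> carrier G \<and> \<kappa> x = 0"
  using letters_closed by (auto simp: slots_def height_mult height_inv)

lemma card_slots: "card (slots H) \<le> (2 * H + 1) * card (insert \<one> letters)"
proof -
  have "card (slots H) \<le> card ({- int H..int H} \<times> insert \<one> letters)"
    unfolding slots_def using finite_letters by (intro card_image_le) auto
  also have "\<dots> = (2 * H + 1) * card (insert \<one> letters)"
    by (simp add: card_cartesian_product nat_add_distrib nat_mult_distrib)
  finally show ?thesis .
qed

text \<open>
  The product of the slots telescopes: each one ends with the inverse of the power of \<open>t\<close> with
  which the next one begins.
\<close>

lemma low_factorization:
  assumes "x \<in> low H n"
  shows "\<bar>\<kappa> x\<bar> \<le> int H \<and> (\<exists>ws. length ws = n \<and> set ws \<subseteq> slots H \<and> x = foldr (\<otimes>) ws \<one> \<otimes> t [^] \<kappa> x)"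
  using assms
proof (induction n arbitrary: x)
  case (Suc n)
  then obtain x' y where xy: "x = x' \<otimes> y" "x' \<in> low H n" "y \<in> insert \<one> letters" "\<bar>\<kappa> x\<bar> \<le> int H"
    by auto
  obtain ws where ws: "length ws = n" "set ws \<subseteq> slots H" "x' = foldr (\<otimes>) ws \<one> \<otimes> t [^] \<kappa> x'"
    and h: "\<bar>\<kappa> x'\<bar> \<le> int H"
    using Suc.IH[OF xy(2)] by blast
  define b where "b = foldr (\<otimes>) ws \<one>"
  have wc: "set ws \<subseteq> carrier G" using ws slots_kernel by auto
  then have b: "b \<in> carrier G" unfolding b_def by (rule foldr_mult_closed)
  have y: "y \<in> carrier G" using xy letter_closed by auto
  have x': "x' \<in> carrier G" using ws(3) b by (metis b_def m_closed pow_t_closed)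
  let ?s = "t [^] \<kappa> x' \<otimes> y \<otimes> inv (t [^] (\<kappa> x' + \<kappa> y))"
  have s: "?s \<in> slots H" unfolding slots_def using h xy by (intro image_eqI[of _ _ "(\<kappa> x', y)"]) auto
  have "x = b \<otimes> t [^] \<kappa> x' \<otimes> y" using xy ws(3) by (simp add: b_def)
  also have "\<dots> = (b \<otimes> ?s) \<otimes> t [^] \<kappa> x" using b y x' by (simp add: xy(1) height_mult m_assoc)
  also have "b \<otimes> ?s = foldr (\<otimes>) (ws @ [?s]) \<one>"
    unfolding b_def using wc y foldr_mult_append[of ws "[?s]"] by (simp del: foldr_append)
  finally have "x = foldr (\<otimes>) (ws @ [?s]) \<one> \<otimes> t [^] \<kappa> x" .
  then show ?case using s ws xy by (intro conjI exI[of _ "ws @ [?s]"]) (simp_all del: foldr_append)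
qed simp

lemma card_low:
  assumes z: "0 < z" "z < (1::real)"
  shows "real (card (low H n)) \<le> real (2 * H + 1) * (1 / z) ^ n *
    ((1 / (1 - z)) ^ card (insert \<one> letters)) ^ (2 * H + 1)"
proof -
  define P where "P = {foldr (\<otimes>) ws \<one> | ws. length ws = n \<and> set ws \<subseteq> slots H}"
  define Q where "Q = 1 / (1 - z)"
  have Q: "1 \<le> Q" "0 < 1 - z" using z by (simp_all add: Q_def field_simps)
  have fs: "finite (slots H)" unfolding slots_def using finite_letters by auto
  have P: "finite P" "real (card P) * z ^ n * (1 - z) ^ card (slots H) \<le> 1"
    unfolding P_def
    using card_products_commuting[OF fs _ _ z, of n] slots_kernel kernel_comm by blast+
  have "real (card P) \<le> (1 / z) ^ n * Q ^ card (slots H)"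
    using P(2) z Q by (simp add: Q_def field_simps)
  also have "\<dots> \<le> (1 / z) ^ n * Q ^ (card (insert \<one> letters) * (2 * H + 1))"
    using z Q card_slots by (intro mult_left_mono power_increasing) (auto simp: mult.commute)
  finally have cP: "real (card P) \<le> (1 / z) ^ n * (Q ^ card (insert \<one> letters)) ^ (2 * H + 1)"
    by (simp only: power_mult)
  have "low H n \<subseteq> (\<lambda>(b, j). b \<otimes> t [^] j) ` (P \<times> {- int H..int H})"
  proof
    fix x assume "x \<in> low H n"
    then obtain ws where "\<bar>\<kappa> x\<bar> \<le> int H" "length ws = n" "set ws \<subseteq> slots H"
      "x = foldr (\<otimes>) ws \<one> \<otimes> t [^] \<kappa> x" using low_factorization by blast
    then show "x \<in> (\<lambda>(b, j). b \<otimes> t [^] j) ` (P \<times> {- int H..int H})"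
      unfolding P_def by (intro image_eqI[of _ _ "(foldr (\<otimes>) ws \<one>, \<kappa> x)"]) auto
  qed
  then have "card (low H n) \<le> card (P \<times> {- int H..int H})"
    using P(1) by (meson card_image_le card_mono finite_SigmaI finite_imageI finite_atLeastAtMost_int order_trans)
  also have "\<dots> = (2 * H + 1) * card P"
    by (simp add: card_cartesian_product nat_add_distrib nat_mult_distrib)
  finally have "real (card (low H n)) \<le> real (2 * H + 1) * real (card P)"
    by (metis of_nat_le_iff of_nat_mult)
  also have "\<dots> \<le> real (2 * H + 1) * ((1 / z) ^ n * (Q ^ card (insert \<one> letters)) ^ (2 * H + 1))"
    by (intro mult_left_mono cP) auto
  finally show ?thesis by (simp add: Q_def mult.assoc)
qed

lemma finite_low: "finite (low H n)"
proof (induction n)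
  case (Suc n)
  have "low H (Suc n) \<subseteq> (\<lambda>(x, y). x \<otimes> y) ` (low H n \<times> insert \<one> letters)" by auto
  then show ?case using Suc finite_letters by (meson finite.insertI finite_SigmaI finite_imageI finite_subset)
qed simp

lemma high_prefix:
  assumes "x \<in> ball n" "x \<notin> low H n"
  shows "\<exists>p r m. x = p \<otimes> r \<and> m \<le> n \<and> p \<in> ball m \<and> r \<in> ball (n - m) \<and> int H < \<bar>\<kappa> p\<bar>"
  using assms
proof (induction n arbitrary: x)
  case (Suc n)
  obtain x' y where xy: "x' \<in> ball n" "y \<in> insert \<one> letters" "x = x' \<otimes> y"
    using Suc.prems(1) by (elim ball_SucE)
  have y: "y \<in> carrier G" "y \<in> ball 1" using xy letter_closed letter_in_ball one_in_ball by auto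
  show ?case
  proof (cases "x' \<in> low H n")
    case True
    then have "int H < \<bar>\<kappa> x\<bar>" using Suc.prems(2) xy by force
    then show ?thesis using Suc.prems(1) ball_closed one_in_ball
      by (intro exI[of _ x] exI[of _ \<one>] exI[of _ "Suc n"]) auto
  next
    case False
    then obtain p r m where *: "x' = p \<otimes> r" "m \<le> n" "p \<in> ball m" "r \<in> ball (n - m)" "int H < \<bar>\<kappa> p\<bar>"
      using Suc.IH[OF xy(1)] by blast
    have "x = p \<otimes> (r \<otimes> y)" using * y xy ball_closed by (simp add: m_assoc)
    moreover have "r \<otimes> y \<in> ball (Suc n - m)" using * y by (intro ball_mult_le) auto
    ultimately show ?thesis using *
      by (intro exI[of _ p] exI[of _ "r \<otimes> y"] exI[of _ m]) auto
  qed
qed (simp add: ball_0)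

section \<open>The gain from insertions\<close>

text \<open>
  The insertion heights lie on the side of zero on which \<open>p\<close> ends, so that \<open>p\<close> passes all of them;
  choosing \<open>j\<close> out of \<open>R * j\<close> leaves at least \<open>R ^ j\<close> possibilities.
\<close>

definition windows :: "nat \<Rightarrow> nat \<Rightarrow> 'a \<Rightarrow> int set set" where
  "windows R j p =
    {I. I \<subseteq> (if 0 < \<kappa> p then {1..int (R * j)} else {- int (R * j)..-1}) \<and> card I = j}"

lemma windows_finite: "I \<in> windows R j p \<Longrightarrow> finite I"
  unfolding windows_def by (auto split: if_splits intro: finite_subset)

lemma windows_on_way:
  assumes "I \<in> windows R j p" "int (gap * (R * j)) < \<bar>\<kappa> p\<bar>" "i \<in> I"
  shows "on_way (int gap * i) (\<kappa> p)"
proof (cases "0 < \<kappa> p")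
  case True
  then have i: "1 \<le> i" "i \<le> int (R * j)" using assms by (auto simp: windows_def)
  then have "int gap * i \<le> int gap * int (R * j)" by (intro mult_left_mono) auto
  then show ?thesis using True assms i by auto
next
  case False
  then have i: "i \<le> -1" "- int (R * j) \<le> i" using assms by (auto simp: windows_def)
  then have "int gap * (- int (R * j)) \<le> int gap * i" by (intro mult_left_mono) auto
  moreover have "int gap * i \<le> 0" using i by (simp add: mult_nonneg_nonpos)
  ultimately show ?thesis using False assms by auto
qed

lemma finite_windows: "finite (windows R j p)"
  unfolding windows_def by (rule finite_subset[of _ "Pow {- int (R * j)..int (R * j)}"]) auto

lemma card_windows:
  assumes "1 \<le> R"
  shows "real R ^ j \<le> real (card (windows R j p))"
proof -
  have "card (windows R j p) = (R * j) choose j"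
    unfolding windows_def using n_subsets[of "{1..int (R * j)}" j] n_subsets[of "{- int (R * j)..-1}" j]
    by (cases "0 < \<kappa> p") (simp_all del: of_nat_mult)
  moreover have "real R ^ j \<le> real ((R * j) choose j)"
  proof (cases "j = 0")
    case False
    then have "real R ^ j = (real (R * j) / real j) ^ j" by simp
    also have "\<dots> \<le> real ((R * j) choose j)"
      using assms by (intro binomial_ge_n_over_k_pow_k) auto
    finally show ?thesis .
  qed simp
  ultimately show ?thesis by simp
qed

text \<open>
  The pairs \<open>(x, I)\<close> are encoded by \<open>(\<alpha>\<^sub>I p, f I r)\<close>, where \<open>x = p r\<close> is the factorization at a
  prefix of large height and \<open>f\<close> says what happens to the second factor.  It is enough that the code determines \<open>x\<close>:
  then \<open>p\<close> is known, hence \<open>\<alpha>\<^sub>I\<close>, hence \<open>I\<close>.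
\<close>

lemma insertion_count:
  assumes R: "1 \<le> R" and X: "X \<subseteq> ball n" and high: "X \<inter> low (gap * (R * j)) n = {}"
    and mem: "\<And>p r l I. p \<otimes> r \<in> X \<Longrightarrow> p \<in> carrier G \<Longrightarrow> r \<in> ball l \<Longrightarrow> finite I \<Longrightarrow> card I = j \<Longrightarrow>
      (\<And>i. i \<in> I \<Longrightarrow> on_way (int gap * i) (\<kappa> p)) \<Longrightarrow> f I r \<in> ball (l + bump_cost * j)"
    and inj: "\<And>p r I p' r' I'. p \<otimes> r \<in> X \<Longrightarrow> p' \<otimes> r' \<in> X \<Longrightarrow> p \<in> carrier G \<Longrightarrow> r \<in> carrier G \<Longrightarrow>
      p' \<in> carrier G \<Longrightarrow> r' \<in> carrier G \<Longrightarrow> finite I \<Longrightarrow> finite I' \<Longrightarrow>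
      bumps I \<otimes> p = bumps I' \<otimes> p' \<Longrightarrow> f I r = f I' r' \<Longrightarrow> p \<otimes> r = p' \<otimes> r'"
  shows "real (card X) * real R ^ j \<le>
    (\<Sum>m\<le>n. real (card (ball (m + bump_cost * j))) * real (card (ball (n - m + bump_cost * j))))"
proof -
  let ?c = "bump_cost * j"
  define B where "B = (\<Union>m\<in>{..n}. ball (m + ?c) \<times> ball (n - m + ?c))"
  have "\<forall>x\<in>X. \<exists>p r m. x = p \<otimes> r \<and> m \<le> n \<and> p \<in> ball m \<and> r \<in> ball (n - m) \<and>
      int (gap * (R * j)) < \<bar>\<kappa> p\<bar>"
    using X high high_prefix[where H = "gap * (R * j)"] by blast
  then obtain p r m where prm: "\<And>x. x \<in> X \<Longrightarrow> x = p x \<otimes> r x \<and> m x \<le> n \<and> p x \<in> ball (m x) \<and>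
      r x \<in> ball (n - m x) \<and> int (gap * (R * j)) < \<bar>\<kappa> (p x)\<bar>"
    by metis
  have pc: "p x \<in> carrier G" "r x \<in> carrier G" "x = p x \<otimes> r x" if "x \<in> X" for x
    using prm[OF that] ball_closed by blast+
  have fX: "finite X" using X finite_ball finite_subset by blast
  define F where "F = (\<lambda>(x, I). (bumps I \<otimes> p x, f I (r x)))"
  define D where "D = Sigma X (\<lambda>x. windows R j (p x))"
  have FB: "F ` D \<subseteq> B"
  proof
    fix w assume "w \<in> F ` D"
    then obtain x I where xI: "x \<in> X" "I \<in> windows R j (p x)" "w = (bumps I \<otimes> p x, f I (r x))"
      by (auto simp: F_def D_def)
    have fI: "finite I" "card I = j" using windows_finite[OF xI(2)] xI(2) unfolding windows_def by blast+
    have ow: "on_way (int gap * i) (\<kappa> (p x))" if "i \<in> I" for i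
      using windows_on_way[OF xI(2) _ that] prm[OF xI(1)] by auto
    have "bumps I \<otimes> p x \<in> ball (m x + bump_cost * card I)"
      by (rule bumps_mult_in_ball[OF fI(1)]) (use prm[OF xI(1)] ow in blast)+
    moreover have "f I (r x) \<in> ball (n - m x + ?c)"
      by (rule mem[of "p x"]) (use prm[OF xI(1)] pc[OF xI(1)] xI ow fI in auto)
    ultimately show "w \<in> B" using prm[OF xI(1)] fI xI(3) unfolding B_def by auto
  qed
  have Finj: "inj_on F D"
  proof (rule inj_onI)
    fix w w' assume "w \<in> D" "w' \<in> D" and eq: "F w = F w'"
    then obtain x I x' I' where w: "w = (x, I)" "w' = (x', I')" and x: "x \<in> X" "x' \<in> X"
      and "I \<in> windows R j (p x)" "I' \<in> windows R j (p x')" by (auto simp: D_def)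
    then have fI: "finite I" "finite I'" using windows_finite by blast+
    have e: "bumps I \<otimes> p x = bumps I' \<otimes> p x'" "f I (r x) = f I' (r x')"
      using eq by (simp_all add: F_def w)
    have "p x \<otimes> r x = p x' \<otimes> r x'"
      by (rule inj[OF _ _ _ _ _ _ fI e]) (use x pc in auto)
    then have xx: "x = x'" using pc x by metis
    then have "bumps I = bumps I'" using e(1) pc x fI by (simp add: bumps_closed)
    then have "I = I'" using bumps_inj fI by simp
    then show "w = w'" using w xx by simp
  qed
  have fB: "finite B" unfolding B_def using finite_ball by auto
  have "real (card X) * real R ^ j = (\<Sum>x\<in>X. real R ^ j)" by simp
  also have "\<dots> \<le> (\<Sum>x\<in>X. real (card (windows R j (p x))))"
    by (intro sum_mono card_windows R)
  also have "\<dots> = real (card D)"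
    unfolding D_def using fX finite_windows by (subst card_SigmaI) auto
  also have "\<dots> \<le> real (card B)"
    using card_inj_on_le[OF Finj FB fB] by simp
  also have "card B \<le> (\<Sum>m\<le>n. card (ball (m + ?c) \<times> ball (n - m + ?c)))"
    unfolding B_def by (rule card_UN_le) simp
  finally show ?thesis by (simp add: card_cartesian_product)
qed

text \<open>
  For an element \<open>x = p r\<close> of height zero, \<open>p\<close> and \<open>inv r\<close> end at the same height, and the bumps
  inserted into both cancel in \<open>(\<alpha>\<^sub>I p) inv(\<alpha>\<^sub>I inv r) = \<alpha>\<^sub>I x inv(\<alpha>\<^sub>I) = x\<close>.
\<close>

lemma insertion_count_kernel:
  assumes "1 \<le> R" "X \<subseteq> ball n" "X \<inter> low (gap * (R * j)) n = {}" "\<And>x. x \<in> X \<Longrightarrow> \<kappa> x = 0"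
  shows "real (card X) * real R ^ j \<le>
    (\<Sum>m\<le>n. real (card (ball (m + bump_cost * j))) * real (card (ball (n - m + bump_cost * j))))"
proof (rule insertion_count[where f = "\<lambda>I r. bumps I \<otimes> inv r", OF assms(1-3)])
  fix p r l I
  assume *: "p \<otimes> r \<in> X" "p \<in> carrier G" "r \<in> ball l" "finite I" "card I = j"
    "\<And>i. i \<in> I \<Longrightarrow> on_way (int gap * i) (\<kappa> p)"
  have "\<kappa> (inv r) = \<kappa> p" using assms(4)[OF *(1)] * ball_closed by (simp add: height_mult height_inv)
  then show "bumps I \<otimes> inv r \<in> ball (l + bump_cost * j)"
    using bumps_mult_in_ball[OF *(4) ball_inv[OF *(3)]] * by simp
next
  fix p r I p' r' I'
  assume *: "p \<otimes> r \<in> X" "p' \<otimes> r' \<in> X" "p \<in> carrier G" "r \<in> carrier G" "p' \<in> carrier G" "r' \<in> carrier G"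
    "finite I" "finite I'" "bumps I \<otimes> p = bumps I' \<otimes> p'" "bumps I \<otimes> inv r = bumps I' \<otimes> inv r'"
  have rec: "p \<otimes> r = (bumps I \<otimes> p) \<otimes> inv (bumps I \<otimes> inv r)"
    if "p \<otimes> r \<in> X" "p \<in> carrier G" "r \<in> carrier G" "finite I" for p r I
  proof -
    have b: "bumps I \<in> carrier G" using that by (simp add: bumps_closed)
    have "(bumps I \<otimes> p) \<otimes> inv (bumps I \<otimes> inv r) = bumps I \<otimes> (p \<otimes> r) \<otimes> inv (bumps I)"
      using that b by (simp add: inv_mult_group m_assoc)
    also have "bumps I \<otimes> (p \<otimes> r) = (p \<otimes> r) \<otimes> bumps I"
      using that b assms(4) by (intro kernel_comm) (auto simp: height_bumps)
    finally show ?thesis using that b by (simp add: m_assoc)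
  qed
  show "p \<otimes> r = p' \<otimes> r'" using rec[of p r I] rec[of p' r' I'] * by simp
qed

text \<open>
  Here only \<open>p\<close> is modified.  The product of the two entries is \<open>\<alpha>\<^sub>I x\<close>, of the same height as \<open>x\<close>; as
  this height determines \<open>\<beta> x\<close>, it leaves only one possibility for the translation part of \<open>\<alpha>\<^sub>I\<close>.
\<close>

lemma insertion_count_determined:
  assumes "1 \<le> R" "X \<subseteq> ball n" "X \<inter> low (gap * (R * j)) n = {}"
    and det: "\<And>x x'. x \<in> X \<Longrightarrow> x' \<in> X \<Longrightarrow> \<kappa> x = \<kappa> x' \<Longrightarrow> \<beta> x = \<beta> x'"
  shows "real (card X) * real R ^ j \<le>
    (\<Sum>m\<le>n. real (card (ball (m + bump_cost * j))) * real (card (ball (n - m + bump_cost * j))))"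
proof (rule insertion_count[where f = "\<lambda>I r. r", OF assms(1-3)])
  fix p r l I
  assume "r \<in> ball l"
  then show "r \<in> ball (l + bump_cost * j)" using ball_mono[of l "l + bump_cost * j"] by auto
next
  fix p r I p' r' I'
  assume *: "p \<otimes> r \<in> X" "p' \<otimes> r' \<in> X" "p \<in> carrier G" "r \<in> carrier G" "p' \<in> carrier G" "r' \<in> carrier G"
    "finite I" "finite I'" "bumps I \<otimes> p = bumps I' \<otimes> p'" "r = r'"
  have b: "bumps I \<in> carrier G" "bumps I' \<in> carrier G" using * by (simp_all add: bumps_closed)
  have e: "bumps I \<otimes> (p \<otimes> r) = bumps I' \<otimes> (p' \<otimes> r')"
    using * b by (simp add: m_assoc[symmetric])
  have "\<kappa> (p \<otimes> r) = \<kappa> (p' \<otimes> r')"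
    using arg_cong[OF e, of \<kappa>] * b by (simp add: height_mult height_bumps)
  then have "\<beta> (p \<otimes> r) = \<beta> (p' \<otimes> r')" using det * by blast
  then have "\<beta> (bumps I) = \<beta> (bumps I')"
    using arg_cong[OF e, of \<beta>] * b by (simp add: trans_mult[of "bumps _"] height_bumps)
  then have "I = I'" using bumps_inj * by blast
  then show "p \<otimes> r = p' \<otimes> r'" using e * b by simp
qed

section \<open>Exponentially small sets\<close>

text \<open>
  The elements \<open>\<alpha>\<^sub>I t\<^sup>k\<close> with \<open>k = gap * q\<close> and \<open>I \<subseteq> {1..q}\<close> are \<open>2 ^ q\<close> distinct ones of length \<open>O(q)\<close>.
\<close>

lemma card_ball_exp_lower: "\<exists>\<delta>>1. \<forall>n. \<delta> ^ n \<le> real (card (ball n))"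
proof -
  obtain \<tau> where \<tau>: "t \<in> ball \<tau>" using ex_ball[OF t_closed] by blast
  define d where "d = \<tau> * gap + bump_cost + 1"
  have pow2: "2 ^ q \<le> real (card (ball (d * q)))" for q
  proof -
    let ?y = "t [^] (gap * q)"
    have y: "?y \<in> ball (\<tau> * (gap * q))" "?y \<in> carrier G" using \<tau> t_closed by (auto intro: ball_pow)
    have ky: "\<kappa> ?y = int (gap * q)" by (metis height_pow_t int_pow_int)
    let ?I = "Pow {1..int q}"
    have fin: "finite I" if "I \<in> ?I" for I using that finite_subset by auto
    have img: "(\<lambda>I. bumps I \<otimes> ?y) ` ?I \<subseteq> ball (d * q)"
    proof
      fix w assume "w \<in> (\<lambda>I. bumps I \<otimes> ?y) ` ?I"
      then obtain I where I: "I \<in> ?I" "w = bumps I \<otimes> ?y" by blast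
      have cI: "card I \<le> q" using I(1) card_mono[of "{1..int q}" I] by auto
      have "w \<in> ball (\<tau> * (gap * q) + bump_cost * card I)"
        unfolding I(2)
      proof (rule bumps_mult_in_ball[OF fin[OF I(1)] y(1)])
        fix i assume "i \<in> I"
        then have "1 \<le> i" "i \<le> int q" using I(1) by auto
        then show "on_way (int gap * i) (\<kappa> ?y)" by (simp add: ky mult_left_mono)
      qed
      moreover have "\<tau> * (gap * q) + bump_cost * card I \<le> d * q"
      proof -
        have "bump_cost * card I \<le> bump_cost * q" by (rule mult_left_mono[OF cI]) simp
        moreover have "d * q = \<tau> * (gap * q) + bump_cost * q + q" by (simp add: d_def algebra_simps)
        ultimately show ?thesis by linarith
      qed
      ultimately show "w \<in> ball (d * q)" using ball_mono by blast
    qed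
    have "inj_on (\<lambda>I. bumps I \<otimes> ?y) ?I"
    proof (rule inj_onI)
      fix I J assume *: "I \<in> ?I" "J \<in> ?I" "bumps I \<otimes> ?y = bumps J \<otimes> ?y"
      then have "bumps I = bumps J" using y(2) fin bumps_closed by simp
      then show "I = J" using bumps_inj fin * by simp
    qed
    then have "card ?I \<le> card (ball (d * q))" using card_inj_on_le[OF _ img finite_ball] by blast
    moreover have "card ?I = 2 ^ q" by (simp add: card_Pow)
    ultimately show ?thesis by (metis of_nat_le_iff of_nat_numeral of_nat_power)
  qed
  have mult: "card (ball (k * n)) \<le> card (ball n) ^ k" for k n
  proof (induction k)
    case (Suc k)
    have "card (ball (Suc k * n)) \<le> card (ball n) * card (ball (k * n))"
      using card_ball_add[of n "k * n"] by simp
    also have "\<dots> \<le> card (ball n) * card (ball n) ^ k" using Suc by simp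
    finally show ?case by simp
  qed (simp add: ball_0)
  have d: "0 < d" by (simp add: d_def)
  have "root d 2 ^ n \<le> real (card (ball n))" for n
  proof -
    have "(root d 2 ^ n) ^ d = 2 ^ n"
      using d by (simp add: power_mult[symmetric] mult.commute[of n]) (simp add: power_mult)
    also have "\<dots> \<le> real (card (ball (d * n)))" by (rule pow2)
    also have "\<dots> \<le> real (card (ball n)) ^ d" using mult[of d n] by (metis of_nat_le_iff of_nat_power)
    finally show ?thesis using d power_le_imp_le_base[of "root d 2 ^ n" "d - 1"] by simp
  qed
  moreover have "1 < root d 2" using d by simp
  ultimately show ?thesis by blast
qed

text \<open>
  The constants are chosen in this order.  \<open>R\<close> makes a choice out of \<open>R ^ j\<close> outweigh the additional length
  \<open>2 * bump_cost * j\<close>, even at the rate \<open>2 * \<gamma>\<close>.  \<open>Z\<close> makes the height \<open>gap * R * j\<close> with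
  \<open>j = n div Z\<close> so small compared with \<open>n\<close> that \<open>low\<close> contributes only about \<open>g ^ (2 * n)\<close>, where
  \<open>g ^ 4 = \<gamma>\<close>.  Finally \<open>\<zeta> ^ (2 * Z) = 2\<close>, so that the remaining gain \<open>2 ^ j\<close>, about \<open>\<zeta> ^ (2 * n)\<close>,
  still beats the error \<open>\<zeta> ^ n\<close> in the upper bound on the growth of the balls.
\<close>

lemma exponentially_small_sets:
  "\<exists>\<theta> C. 0 < \<theta> \<and> \<theta> < 1 \<and> 0 < C \<and> (\<forall>n X. X \<subseteq> ball n \<longrightarrow>
    (\<forall>x\<in>X. \<kappa> x = 0) \<or> (\<forall>x\<in>X. \<forall>x'\<in>X. \<kappa> x = \<kappa> x' \<longrightarrow> \<beta> x = \<beta> x') \<longrightarrow>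
    real (card X) \<le> C * (real n + 1) * \<theta> ^ n * real (card (ball n)))"
proof -
  define b where "b n = real (card (ball n))" for n
  have b1: "1 \<le> b n" for n unfolding b_def using card_ball_pos[of n] by simp
  have bsub: "b (m + n) \<le> b m * b n" for m n
    unfolding b_def using card_ball_add by (metis of_nat_le_iff of_nat_mult)
  obtain \<gamma> where "1 \<le> \<gamma>" and lower: "\<And>n. \<gamma> ^ n \<le> b n"
    and upper: "\<And>\<zeta>. 1 < \<zeta> \<Longrightarrow> \<exists>C>0. \<forall>n. b n \<le> C * (\<zeta> * \<gamma>) ^ n"
    and greatest: "\<And>\<delta>. 0 \<le> \<delta> \<Longrightarrow> (\<And>n. \<delta> ^ n \<le> b n) \<Longrightarrow> \<delta> \<le> \<gamma>"
    using submultiplicative_growth_rate[of b] b1 bsub by blast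
  obtain \<delta> where "1 < \<delta>" "\<And>n. \<delta> ^ n \<le> b n" using card_ball_exp_lower unfolding b_def by blast
  then have "\<delta> \<le> \<gamma>" by (intro greatest) auto
  with \<open>1 < \<delta>\<close> have \<gamma>: "1 < \<gamma>" by simp
  let ?c = bump_cost
  obtain R where "2 * (2 * \<gamma>) ^ (2 * ?c) < real R" using reals_Archimedean2 by blast
  then have R: "2 * (2 * \<gamma>) ^ (2 * ?c) \<le> real R" by simp
  have "0 < 2 * (2 * \<gamma>) ^ (2 * ?c)" using \<gamma> by simp
  then have "0 < real R" using R by linarith
  then have R1: "1 \<le> R" by simp
  define g where "g = root 4 \<gamma>"
  have g: "1 < g" "g ^ 4 = \<gamma>" using \<gamma> by (simp_all add: g_def)
  define z where "z = 1 / g"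
  have z: "0 < z" "z < 1" using g by (simp_all add: z_def)
  define Q where "Q = (1 / (1 - z)) ^ card (insert \<one> letters)"
  have Q: "1 \<le> Q" unfolding Q_def using z by (intro one_le_power) simp
  obtain Z0 where Z0: "Q ^ (2 * gap * R) < g ^ Z0" using real_arch_pow[OF g(1)] by blast
  define Z where "Z = Suc Z0"
  have "g ^ Z0 \<le> g ^ Z" using g by (intro power_increasing) (auto simp: Z_def)
  with Z0 have Z: "Q ^ (2 * gap * R) \<le> g ^ Z" "0 < Z" by (simp_all add: Z_def)
  define \<zeta> where "\<zeta> = root (2 * Z) 2"
  have \<zeta>: "1 < \<zeta>" "\<zeta> ^ (2 * Z) = 2" using Z by (simp_all add: \<zeta>_def)
  have \<zeta>2: "\<zeta> \<le> 2"
  proof -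
    have "\<zeta> ^ 1 \<le> \<zeta> ^ (2 * Z)" using \<zeta>(1) Z by (intro power_increasing) auto
    then show ?thesis using \<zeta> by simp
  qed
  obtain C0 where C0: "0 < C0" "\<And>n. b n \<le> C0 * (\<zeta> * \<gamma>) ^ n" using upper[OF \<zeta>(1)] by blast
  define \<theta> where "\<theta> = max (1 / \<zeta>) (1 / g ^ 2)"
  define C1 where "C1 = 2 * real gap * real R * Q"
  have C1: "0 < C1" using gap R1 Q by (simp add: C1_def)
  have \<theta>: "0 < \<theta>" "\<theta> < 1" "1 / \<zeta> \<le> \<theta>" "1 / g ^ 2 \<le> \<theta>"
    using \<zeta>(1) g(1) by (auto simp: \<theta>_def less_max_iff_disj)
  have main: "real (card X) \<le> (C1 + 2 * C0\<^sup>2) * (real n + 1) * \<theta> ^ n * b n"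
    if X: "X \<subseteq> ball n" and cond: "(\<forall>x\<in>X. \<kappa> x = 0) \<or> (\<forall>x\<in>X. \<forall>x'\<in>X. \<kappa> x = \<kappa> x' \<longrightarrow> \<beta> x = \<beta> x')"
    for n X
  proof -
    define j where "j = n div Z"
    define H where "H = gap * (R * j)"
    have jn: "Z * j \<le> n" "n < Z * j + Z" unfolding j_def using Z(2)
      using dividend_less_times_div[OF Z(2), of n] by (auto simp: mult.commute)
    have low: "real (card (low H n)) \<le> C1 * (real n + 1) * \<theta> ^ n * b n"
    proof -
      have "real (card (low H n)) \<le> real (2 * H + 1) * (1 / z) ^ n * Q ^ (2 * H + 1)"
        unfolding Q_def by (rule card_low[OF z])
      also have "Q ^ (2 * H + 1) = Q * (Q ^ (2 * gap * R)) ^ j"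
        by (simp add: H_def power_mult[symmetric] mult.assoc)
      also have "1 / z = g" by (simp add: z_def)
      also have "real (2 * H + 1) * g ^ n * (Q * (Q ^ (2 * gap * R)) ^ j) \<le>
          (2 * real gap * real R * (real n + 1)) * g ^ n * (Q * g ^ n)"
      proof (intro mult_mono)
        have "j \<le> n" using jn Z(2) by (metis div_le_dividend j_def)
        then have "H \<le> gap * R * n" by (simp add: H_def mult.assoc)
        moreover have "1 \<le> gap * R" using gap(2) R1 by simp
        moreover have "2 * (gap * R) * (n + 1) = 2 * (gap * R * n) + 2 * (gap * R)" by (simp add: algebra_simps)
        ultimately have "2 * H + 1 \<le> 2 * (gap * R) * (n + 1)" by linarith
        then have "real (2 * H + 1) \<le> real (2 * (gap * R) * (n + 1))" by (simp only: of_nat_le_iff)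
        then show "real (2 * H + 1) \<le> 2 * real gap * real R * (real n + 1)" by (simp add: algebra_simps)
        have "(Q ^ (2 * gap * R)) ^ j \<le> (g ^ Z) ^ j" using Z(1) Q by (intro power_mono) auto
        also have "\<dots> \<le> g ^ n" using jn g by (simp add: power_mult[symmetric])
        finally show "(Q ^ (2 * gap * R)) ^ j \<le> g ^ n" .
      qed (use Q g in auto)
      also have "\<dots> = C1 * (real n + 1) * (g ^ 2) ^ n"
        by (simp add: C1_def power2_eq_square power_mult_distrib)
      also have "(g ^ 2) ^ n = (1 / g ^ 2) ^ n * \<gamma> ^ n"
      proof -
        have "g ^ 2 = (1 / g ^ 2) * \<gamma>" using g by (simp add: g(2)[symmetric] power_numeral_reduce)
        then show ?thesis by (metis power_mult_distrib)
      qed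
      also have "C1 * (real n + 1) * ((1 / g ^ 2) ^ n * \<gamma> ^ n) \<le> C1 * (real n + 1) * (\<theta> ^ n * b n)"
        using \<theta> lower \<gamma> C1 g by (intro mult_left_mono mult_mono power_mono) auto
      finally show ?thesis by (simp add: mult.assoc)
    qed
    define X' where "X' = X - low H n"
    have high: "real (card X') \<le> 2 * C0\<^sup>2 * (real n + 1) * \<theta> ^ n * b n"
    proof -
      let ?h = "\<zeta> * \<gamma>"
      have h0: "0 < ?h" using \<zeta>(1) \<gamma> by simp
      have X': "X' \<subseteq> ball n" "X' \<inter> low (gap * (R * j)) n = {}" using X by (auto simp: X'_def H_def)
      have "real (card X') * real R ^ j \<le> (\<Sum>m\<le>n. b (m + ?c * j) * b (n - m + ?c * j))"
        using cond
      proof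
        assume "\<forall>x\<in>X. \<kappa> x = 0"
        then show ?thesis unfolding b_def
          by (intro insertion_count_kernel[OF R1 X']) (auto simp: X'_def)
      next
        assume "\<forall>x\<in>X. \<forall>x'\<in>X. \<kappa> x = \<kappa> x' \<longrightarrow> \<beta> x = \<beta> x'"
        then show ?thesis unfolding b_def
          by (intro insertion_count_determined[OF R1 X']) (auto simp: X'_def)
      qed
      also have "\<dots> \<le> (\<Sum>m\<le>n. C0\<^sup>2 * ?h ^ n * (?h ^ (2 * ?c)) ^ j)"
      proof (rule sum_mono)
        fix m assume "m \<in> {..n}"
        then have e: "(m + ?c * j) + (n - m + ?c * j) = n + 2 * ?c * j" by simp
        have "b (m + ?c * j) * b (n - m + ?c * j) \<le>
            (C0 * ?h ^ (m + ?c * j)) * (C0 * ?h ^ (n - m + ?c * j))"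
          using C0 b1 h0 by (intro mult_mono) (auto intro: order_trans[OF zero_le_one])
        also have "\<dots> = C0\<^sup>2 * ?h ^ ((m + ?c * j) + (n - m + ?c * j))"
          by (simp only: power_add power2_eq_square mult_ac)
        finally show "b (m + ?c * j) * b (n - m + ?c * j) \<le> C0\<^sup>2 * ?h ^ n * (?h ^ (2 * ?c)) ^ j"
          unfolding e by (simp add: power_add power_mult)
      qed
      also have "\<dots> = (real n + 1) * (C0\<^sup>2 * ?h ^ n * (?h ^ (2 * ?c)) ^ j)" by simp
      finally have 1: "real (card X') * real R ^ j \<le> ((real n + 1) * C0\<^sup>2 * ?h ^ n) * (?h ^ (2 * ?c)) ^ j"
        by (simp only: mult.assoc)
      have "2 * ?h ^ (2 * ?c) \<le> 2 * (2 * \<gamma>) ^ (2 * ?c)"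
        using \<zeta>2 \<gamma> h0 by (intro mult_left_mono power_mono mult_right_mono) auto
      then have "2 * ?h ^ (2 * ?c) \<le> real R" using R by linarith
      then have "(2 * ?h ^ (2 * ?c)) ^ j \<le> real R ^ j" using h0 by (intro power_mono) auto
      then have "real (card X') * (2 ^ j * (?h ^ (2 * ?c)) ^ j) \<le> real (card X') * real R ^ j"
        by (intro mult_left_mono) (simp_all add: power_mult_distrib)
      with 1 have "(real (card X') * 2 ^ j) * (?h ^ (2 * ?c)) ^ j \<le>
          ((real n + 1) * C0\<^sup>2 * ?h ^ n) * (?h ^ (2 * ?c)) ^ j" by (simp add: mult.assoc)
      then have 2: "real (card X') * 2 ^ j \<le> (real n + 1) * C0\<^sup>2 * ?h ^ n"
        using h0 by (simp add: mult_le_cancel_right_pos)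
      have "\<zeta> ^ n * \<zeta> ^ n = \<zeta> ^ (2 * n)" by (simp add: mult_2 power_add)
      also have "\<dots> \<le> \<zeta> ^ (2 * Z * (j + 1))"
        using jn \<zeta>(1) by (intro power_increasing) (auto simp: algebra_simps)
      also have "\<dots> = (\<zeta> ^ (2 * Z)) ^ (j + 1)" by (rule power_mult)
      also have "\<dots> = 2 * 2 ^ j" unfolding \<zeta>(2) by simp
      finally have "real (card X') * (\<zeta> ^ n * \<zeta> ^ n) \<le> real (card X') * (2 * 2 ^ j)"
        by (intro mult_left_mono) auto
      also have "\<dots> \<le> 2 * ((real n + 1) * C0\<^sup>2 * ?h ^ n)" using 2 by simp
      also have "\<dots> = (2 * C0\<^sup>2 * (real n + 1) * \<gamma> ^ n) * \<zeta> ^ n" by (simp add: power_mult_distrib)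
      finally have "(real (card X') * \<zeta> ^ n) * \<zeta> ^ n \<le> (2 * C0\<^sup>2 * (real n + 1) * \<gamma> ^ n) * \<zeta> ^ n"
        by (simp only: mult.assoc)
      then have "real (card X') * \<zeta> ^ n \<le> 2 * C0\<^sup>2 * (real n + 1) * \<gamma> ^ n"
        using \<zeta>(1) by (simp add: mult_le_cancel_right_pos)
      then have "real (card X') \<le> 2 * C0\<^sup>2 * (real n + 1) * ((1 / \<zeta>) ^ n * \<gamma> ^ n)"
        using \<zeta>(1) by (simp add: field_simps)
      also have "\<dots> \<le> 2 * C0\<^sup>2 * (real n + 1) * (\<theta> ^ n * b n)"
        using \<theta> lower \<gamma> \<zeta>(1) by (intro mult_left_mono mult_mono power_mono) auto
      finally show ?thesis by (simp add: mult.assoc)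
    qed
    have "card X \<le> card (low H n \<union> X')"
      using finite_subset[OF X finite_ball] finite_low by (intro card_mono) (auto simp: X'_def)
    also have "\<dots> \<le> card (low H n) + card X'" by (rule card_Un_le)
    finally have "real (card X) \<le> real (card (low H n)) + real (card X')" by linarith
    also have "\<dots> \<le> (C1 + 2 * C0\<^sup>2) * (real n + 1) * \<theta> ^ n * b n"
      using low high by (simp add: algebra_simps)
    finally show ?thesis .
  qed
  have "0 < C1 + 2 * C0\<^sup>2" using C1 by (simp add: add_pos_nonneg)
  with \<theta>(1,2) main show ?thesis unfolding b_def by blast
qed

section \<open>Tuples with trivial iterated commutator\<close>

theorem comm_tuples_exp_negligible:
  assumes "1 \<le> r"
  shows "exp_negligible G Y (r + 1) (comm_tuples G r)"
proof -
  obtain \<theta> C where \<theta>: "0 < \<theta>" "\<theta> < 1" and C: "0 < C"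
    and small: "\<And>n X. X \<subseteq> ball n \<Longrightarrow>
      (\<forall>x\<in>X. \<kappa> x = 0) \<or> (\<forall>x\<in>X. \<forall>x'\<in>X. \<kappa> x = \<kappa> x' \<longrightarrow> \<beta> x = \<beta> x') \<Longrightarrow>
      real (card X) \<le> C * (real n + 1) * \<theta> ^ n * real (card (ball n))"
    using exponentially_small_sets by metis
  \<comment> \<open>\<open>T 0\<close> is the condition on \<open>x\<^sub>0\<close> given the other entries, \<open>T i\<close> for \<open>i \<ge> 1\<close> a condition on \<open>x\<^sub>i\<close> alone.\<close>
  define T where "T i = (if i = 0
    then {xs. \<kappa> (xs ! 1) \<noteq> 0 \<and> \<beta> (group_comm G (xs ! 0) (xs ! 1)) = 0}
    else {xs. \<kappa> (xs ! i) = 0})" for i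
  have cover: "comm_tuples G r \<subseteq> (\<Union>i\<le>r. T i)"
  proof
    fix xs assume xs: "xs \<in> comm_tuples G r"
    then obtain x y zs where l: "xs = x # y # zs" "length zs + 1 = r"
      using assms by (auto simp: comm_tuples_def tuples_def length_Suc_conv dest!: Suc_le_D)
    have c: "x \<in> carrier G" "y \<in> carrier G" "set zs \<subseteq> carrier G"
      using xs l by (auto simp: comm_tuples_def tuples_def)
    show "xs \<in> (\<Union>i\<le>r. T i)"
    proof (rule ccontr)
      assume "xs \<notin> (\<Union>i\<le>r. T i)"
      then have n: "xs \<notin> T i" if "i \<le> r" for i using that by blast
      have y: "\<kappa> y \<noteq> 0" using n[of 1] assms by (simp add: T_def l)
      then have "\<beta> (group_comm G x y) \<noteq> 0" using n[of 0] by (simp add: T_def l)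
      moreover have "\<kappa> z \<noteq> 0" if z: "z \<in> set zs" for z
      proof -
        obtain k where "k < length zs" "z = zs ! k" using z by (auto simp: in_set_conv_nth)
        then show ?thesis using n[of "k + 2"] l(2) by (simp add: T_def l(1))
      qed
      ultimately have "\<beta> (foldl (group_comm G) (group_comm G x y) zs) \<noteq> 0"
        using c by (intro trans_foldl_comm_nonzero) (auto simp: group_comm_closed height_comm)
      moreover have "foldl (group_comm G) (group_comm G x y) zs = \<one>"
        using xs by (simp add: comm_tuples_def iterated_comm_def l)
      ultimately show False by simp
    qed
  qed
  have slice: "real (card (T i \<inter> tuples (ball n) (Suc r))) \<le>
      C * (real n + 1) * \<theta> ^ n * real (card (ball n)) * real (card (ball n)) ^ r" if i: "i \<le> r" for i n
  proof (rule card_slices[OF finite_ball i])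
    show "0 \<le> C * (real n + 1) * \<theta> ^ n * real (card (ball n))" using C \<theta> by simp
    fix ys assume ys: "ys \<in> tuples (ball n) r"
    let ?X = "{z \<in> ball n. take i ys @ z # drop i ys \<in> T i}"
    show "real (card ?X) \<le> C * (real n + 1) * \<theta> ^ n * real (card (ball n))"
    proof (rule small)
      have len: "length ys = r" and ysb: "set ys \<subseteq> ball n" using ys by (auto simp: tuples_def)
      show "(\<forall>x\<in>?X. \<kappa> x = 0) \<or> (\<forall>x\<in>?X. \<forall>x'\<in>?X. \<kappa> x = \<kappa> x' \<longrightarrow> \<beta> x = \<beta> x')"
      proof (cases "i = 0")
        case True
        have "0 < length ys" using len assms by simp
        then have y: "ys ! 0 \<in> carrier G" using ysb ball_closed nth_mem by blast
        have "\<beta> x = \<beta> x'" if "x \<in> ?X" "x' \<in> ?X" "\<kappa> x = \<kappa> x'" for x x'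
        proof -
          let ?y = "ys ! 0"
          have e: "\<kappa> ?y \<noteq> 0" "\<beta> (group_comm G x ?y) = 0" "\<beta> (group_comm G x' ?y) = 0"
            using that True by (auto simp: T_def)
          have "x \<in> carrier G" "x' \<in> carrier G" using that ball_closed by auto
          then have "\<beta> x * (1 - \<mu> powi \<kappa> ?y) = \<beta> x' * (1 - \<mu> powi \<kappa> ?y)"
            using trans_determined_by_height_if_commuting[of x ?y]
              trans_determined_by_height_if_commuting[of x' ?y] e y that(3) by simp
          moreover have "1 - \<mu> powi \<kappa> ?y \<noteq> 0" using powi_mu_eq_1[of "\<kappa> ?y"] e(1) by simp
          ultimately show ?thesis by simp
        qed
        then show ?thesis by blast
      next
        case False
        then have "\<kappa> x = 0" if "x \<in> ?X" for x
          using that i len by (simp add: T_def nth_append)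
        then show ?thesis by blast
      qed
    qed blast
  qed
  show ?thesis
  proof (rule exp_negligible_if_ratio_bound[OF _ \<theta>])
    show "comm_tuples G r \<subseteq> tuples (carrier G) (r + 1)" by (auto simp: comm_tuples_def)
    fix n
    let ?b = "real (card (ball n))" and ?V = "tuples (ball n) (Suc r)"
    have b: "0 < ?b" using card_ball_pos[of n] by simp
    have fin: "finite ?V" using finite_lists_length_eq[OF finite_ball, of n "Suc r"]
      by (simp add: tuples_def conj_commute)
    have "card (comm_tuples G r \<inter> ?V) \<le> card (\<Union>i\<le>r. T i \<inter> ?V)"
      using cover fin by (intro card_mono) auto
    also have "\<dots> \<le> (\<Sum>i\<le>r. card (T i \<inter> ?V))" by (rule card_UN_le) simp
    finally have "real (card (comm_tuples G r \<inter> ?V)) \<le> (\<Sum>i\<le>r. real (card (T i \<inter> ?V)))"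
      by (metis of_nat_le_iff of_nat_sum)
    also have "\<dots> \<le> (\<Sum>i\<le>r. C * (real n + 1) * \<theta> ^ n * ?b * ?b ^ r)"
      by (intro sum_mono slice) simp
    also have "\<dots> = (real (Suc r) * C) * (real n + 1) * \<theta> ^ n * ?b ^ (r + 1)" by (simp add: mult_ac)
    finally show "real (card (comm_tuples G r \<inter> tuples (ball n) (r + 1))) / ?b ^ (r + 1)
        \<le> (real (Suc r) * C) * (real n + 1) * \<theta> ^ n"
      using b by (subst pos_divide_le_eq) (auto simp del: power_Suc)
  qed
qed

end

section \<open>The groups \<open>BS(1,N)\<close>\<close>

text \<open>
  \<open>BS(1,N)\<close> acts by \<open>a : z \<mapsto> z + 1\<close> and \<open>t : z \<mapsto> N z\<close>; height and translation part are
  computed on words and then seen to respect the defining relation.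
\<close>

fun letter_height :: "bs_gen \<times> bool \<Rightarrow> int" where
  "letter_height (BS_a, s) = 0"
| "letter_height (BS_t, s) = (if s then 1 else -1)"

fun letter_trans :: "bs_gen \<times> bool \<Rightarrow> complex" where
  "letter_trans (BS_a, s) = (if s then 1 else -1)"
| "letter_trans (BS_t, s) = 0"

fun bs_height :: "bs_gen word \<Rightarrow> int" where
  "bs_height [] = 0"
| "bs_height (l # u) = letter_height l + bs_height u"

fun bs_trans :: "complex \<Rightarrow> bs_gen word \<Rightarrow> complex" where
  "bs_trans \<mu> [] = 0"
| "bs_trans \<mu> (l # u) = letter_trans l + \<mu> powi letter_height l * bs_trans \<mu> u"

lemma bs_height_append: "bs_height (u @ v) = bs_height u + bs_height v"
  by (induction u) auto

lemma bs_trans_append: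
  "\<mu> \<noteq> 0 \<Longrightarrow> bs_trans \<mu> (u @ v) = bs_trans \<mu> u + \<mu> powi bs_height u * bs_trans \<mu> v"
  by (induction u) (auto simp: power_int_add algebra_simps)

definition bs_rel :: "int \<Rightarrow> (bs_gen word \<times> bs_gen word) set" where
  "bs_rel N = {([(BS_t, True), (BS_a, True), (BS_t, False)], word_pow BS_a N)}"

lemma bs_height_replicate: "bs_height (replicate k (BS_a, s)) = 0"
  by (induction k) auto

lemma bs_trans_replicate: "bs_trans \<mu> (replicate k (BS_a, s)) = (if s then of_nat k else - of_nat k)"
  by (induction k) auto

lemma bs_trans_word_pow: "bs_trans \<mu> (word_pow BS_a N) = of_int N"
  by (cases N rule: int_cases2) (auto simp: word_pow_def bs_trans_replicate)

lemma bs_invariant: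
  assumes "word_equiv (bs_rel N) u v" "N \<noteq> 0"
  shows "bs_height u = bs_height v \<and> bs_trans (of_int N) u = bs_trans (of_int N) v"
  using assms
proof (induction rule: word_equiv.induct)
  case (cancel u x b v)
  define p where "p = [(x, b), (x, \<not> b)]"
  have "bs_height p = 0 \<and> bs_trans (of_int N) p = 0"
    using cancel by (cases x) (auto simp: p_def power_int_minus)
  then show ?case using cancel by (simp add: bs_height_append bs_trans_append flip: p_def)
next
  case (relation l r u v)
  then have lr: "l = [(BS_t, True), (BS_a, True), (BS_t, False)]" "r = word_pow BS_a N"
    by (auto simp: bs_rel_def)
  have "bs_height l = bs_height r" by (simp add: lr word_pow_def bs_height_replicate)
  moreover have "bs_trans (of_int N) l = bs_trans (of_int N) r"
    by (simp add: lr bs_trans_word_pow)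
  ultimately show ?case using relation by (simp add: bs_height_append bs_trans_append)
qed auto

locale BS = group G for G (structure) and N :: int +
  assumes G_def: "G = BS1 N" and N: "2 \<le> \<bar>N\<bar>"
begin

abbreviation wc where "wc \<equiv> word_class (bs_rel N)"

definition "ga = wc [(BS_a, True)]"
definition "gt = wc [(BS_t, True)]"

lemma G_presented: "G = presented_group (bs_rel N)"
  by (simp add: G_def BS1_def bs_rel_def)

lemma carrier_BS: "carrier G = range wc"
  by (simp add: G_presented presented_group_def)

lemma one_BS: "\<one> = wc []"
  by (simp add: G_presented presented_group_def)

lemma mult_BS: "wc u \<otimes> wc v = wc (u @ v)"
  by (simp add: G_presented presented_group_mult)

lemma gens_closed: "ga \<in> carrier G" "gt \<in> carrier G"
  by (auto simp: ga_def gt_def carrier_BS)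

lemma cancel_left:
  assumes "x \<in> carrier G" "y \<in> carrier G"
  shows "inv x \<otimes> (x \<otimes> y) = y" "x \<otimes> (inv x \<otimes> y) = y"
  using assms by (simp_all add: m_assoc[symmetric])

lemma inv_pow_Suc:
  assumes "x \<in> carrier G"
  shows "inv (x [^] Suc i) = inv (x [^] i) \<otimes> inv x" "inv (x [^] Suc i) = inv x \<otimes> inv (x [^] i)"
  unfolding nat_pow_Suc2[OF assms] by (rule inv_mult_group; use assms in simp)
    (use assms in \<open>simp add: nat_pow_Suc2[OF assms, symmetric] inv_mult_group\<close>)

lemma inv_gens: "wc [(BS_a, False)] = inv ga" "wc [(BS_t, False)] = inv gt"
proof -
  have "wc [(x, False)] = inv (wc [(x, True)])" for x
  proof (rule inv_equality[symmetric])
    have "word_equiv (bs_rel N) ([] @ [(x, False), (x, \<not> False)] @ []) ([] @ [])"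
      by (rule word_equiv.cancel)
    then show "wc [(x, False)] \<otimes> wc [(x, True)] = \<one>"
      by (simp add: mult_BS one_BS word_class_eq_iff)
  qed (auto simp: carrier_BS)
  then show "wc [(BS_a, False)] = inv ga" "wc [(BS_t, False)] = inv gt"
    by (simp_all add: ga_def gt_def)
qed

lemma word_pow_ga: "wc (word_pow BS_a k) = ga [^] k"
proof -
  have rep: "wc (replicate n (x, s)) = wc [(x, s)] [^] n" for n x s
  proof (induction n)
    case (Suc n)
    have "wc (replicate (Suc n) (x, s)) = wc (replicate n (x, s) @ [(x, s)])"
      by (simp add: replicate_append_same)
    then show ?case using Suc by (simp flip: mult_BS)
  qed (simp add: one_BS)
  show ?thesis
  proof (cases k rule: int_cases2)
    case (nonneg n)
    then show ?thesis using rep[of n BS_a True] by (simp add: word_pow_def ga_def int_pow_int)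
  next
    case (nonpos n)
    then show ?thesis using rep[of n BS_a "k = 0"] inv_gens gens_closed
      by (cases "n = 0") (auto simp: word_pow_def one_BS int_pow_neg_int nat_pow_inv)
  qed
qed

lemma gt_ga: "gt \<otimes> ga \<otimes> inv gt = ga [^] N"
proof -
  have "word_equiv (bs_rel N) ([] @ [(BS_t, True), (BS_a, True), (BS_t, False)] @ []) ([] @ word_pow BS_a N @ [])"
    by (rule word_equiv.relation) (simp add: bs_rel_def)
  then have "wc [(BS_t, True), (BS_a, True), (BS_t, False)] = ga [^] N"
    by (simp add: word_class_eq_iff flip: word_pow_ga)
  then show ?thesis unfolding inv_gens(2)[symmetric] by (simp add: ga_def gt_def mult_BS)
qed

lemma gt_pow_ga: "gt \<otimes> ga [^] (j::int) = ga [^] (N * j) \<otimes> gt"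
proof -
  let ?c = "\<lambda>x. gt \<otimes> x \<otimes> inv gt"
  have "?c \<in> hom G G"
    using gens_closed by (intro homI) (auto simp: m_assoc cancel_left)
  then have "?c (ga [^] j) = ?c ga [^] j"
    using gens_closed is_group by (intro hom_int_pow) auto
  also have "\<dots> = ga [^] (N * j)" using gens_closed by (simp add: gt_ga int_pow_pow)
  finally have "?c (ga [^] j) \<otimes> gt = ga [^] (N * j) \<otimes> gt" by simp
  then show ?thesis using gens_closed by (simp add: m_assoc)
qed

text \<open>
  Every element has the form \<open>t\<^sup>-\<^sup>i a\<^sup>j t\<^sup>l\<close>, where \<open>i\<close> may be increased at will because conjugating a power of
  \<open>a\<close> by \<open>t\<close> gives a power of \<open>a\<close>.  The elements of height zero are those with \<open>l = i\<close>; two of them can be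
  written with the same \<open>i\<close>, and then they visibly commute.
\<close>

definition nf :: "nat \<Rightarrow> int \<Rightarrow> int \<Rightarrow> bs_gen word set" where
  "nf i j l = inv (gt [^] i) \<otimes> ga [^] j \<otimes> gt [^] l"

lemma nf_raise: "nf (Suc i) (N * j) (l + 1) = nf i j l"
proof -
  have c: "gt \<in> carrier G" "ga \<in> carrier G" by (rule gens_closed)+
  have "nf (Suc i) (N * j) (l + 1) =
      inv (gt [^] i) \<otimes> (inv gt \<otimes> (ga [^] (N * j) \<otimes> gt)) \<otimes> gt [^] l"
    unfolding nf_def inv_pow_Suc(1)[OF c(1)] using c int_pow_mult[of gt 1 l]
    by (simp add: m_assoc add.commute)
  also have "inv gt \<otimes> (ga [^] (N * j) \<otimes> gt) = ga [^] j"
    unfolding gt_pow_ga[symmetric] using c by (simp add: cancel_left)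
  finally show ?thesis by (simp add: nf_def)
qed

lemma nf_exists: "\<exists>i j l. wc u = nf i j l"
proof (induction u)
  case Nil
  show ?case by (intro exI[of _ 0]) (simp add: nf_def one_BS[symmetric])
next
  case (Cons x u)
  have c: "gt \<in> carrier G" "ga \<in> carrier G" by (rule gens_closed)+
  obtain i j l where ijl: "wc u = nf i j l" using Cons by blast
  have wcx: "wc (x # u) = wc [x] \<otimes> nf i j l" by (simp add: mult_BS ijl[symmetric])
  have t_up: "\<exists>i' j' l'. gt \<otimes> nf i j l = nf i' j' l'"
  proof -
    have "gt \<otimes> nf (Suc i) (N * j) (l + 1) = nf i (N * j) (l + 1)"
      unfolding nf_def inv_pow_Suc(2)[OF c(1)] using c by (simp add: m_assoc cancel_left)
    then show ?thesis unfolding nf_raise by blast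
  qed
  have t_down: "inv gt \<otimes> nf i j l = nf (Suc i) j l" for i j l
    unfolding nf_def inv_pow_Suc(2)[OF c(1)] using c by (simp add: m_assoc)
  have a_gen: "\<exists>j'. ga [^] (k::int) \<otimes> nf i j l = nf i j' l" for k
  proof (induction i arbitrary: j k l)
    case 0
    have "ga [^] k \<otimes> nf 0 j l = nf 0 (k + j) l"
      unfolding nf_def using c by (simp add: m_assoc[symmetric] int_pow_mult)
    then show ?case by blast
  next
    case (Suc i)
    obtain j' where j': "ga [^] (N * k) \<otimes> nf i j l = nf i j' l" using Suc by blast
    have n: "nf i j l \<in> carrier G" unfolding nf_def using c by auto
    have comm: "ga [^] k \<otimes> inv gt = inv gt \<otimes> ga [^] (N * k)"
    proof -
      have "ga [^] (N * k) = gt \<otimes> ga [^] k \<otimes> inv gt"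
        unfolding gt_pow_ga using c by (simp add: m_assoc)
      then show ?thesis using c by (simp add: m_assoc cancel_left)
    qed
    have "ga [^] k \<otimes> nf (Suc i) j l = (ga [^] k \<otimes> inv gt) \<otimes> nf i j l"
      unfolding t_down[symmetric] using c n by (simp add: m_assoc)
    also have "\<dots> = nf (Suc i) j' l"
      unfolding comm t_down[symmetric] j'[symmetric] using c n by (simp add: m_assoc)
    finally show ?case by blast
  qed
  obtain y s where x: "x = (y, s)" by force
  show ?case
  proof (cases y)
    case BS_a
    then have "wc [x] = ga [^] (if s then 1 else -1 :: int)"
      using c inv_gens int_pow_neg[of ga 1] by (auto simp: x ga_def)
    then show ?thesis using a_gen wcx by metis
  next
    case BS_t
    then have "wc [x] = (if s then gt else inv gt)" using inv_gens by (auto simp: x gt_def)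
    then show ?thesis using t_up t_down wcx by metis
  qed
qed

definition hgt :: "bs_gen word set \<Rightarrow> int" where
  "hgt x = bs_height (SOME u. wc u = x)"

definition tr :: "bs_gen word set \<Rightarrow> complex" where
  "tr x = bs_trans (of_int N) (SOME u. wc u = x)"

lemma hgt_wc: "hgt (wc u) = bs_height u" and tr_wc: "tr (wc u) = bs_trans (of_int N) u"
proof -
  have "wc (SOME v. wc v = wc u) = wc u" by (rule someI) simp
  then have "word_equiv (bs_rel N) (SOME v. wc v = wc u) u" by (simp add: word_class_eq_iff)
  then show "hgt (wc u) = bs_height u" "tr (wc u) = bs_trans (of_int N) u"
    using bs_invariant[of N] N by (auto simp: hgt_def tr_def)
qed

lemma hgt_mult: "x \<in> carrier G \<Longrightarrow> y \<in> carrier G \<Longrightarrow> hgt (x \<otimes> y) = hgt x + hgt y"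
  by (auto simp: carrier_BS mult_BS hgt_wc bs_height_append)

lemma nf_height_0_comm:
  "nf i j (int i) \<otimes> nf i j' (int i) = nf i (j + j') (int i)"
  unfolding nf_def using gens_closed
  by (simp add: int_pow_int m_assoc cancel_left int_pow_mult)

lemma hgt_nf: "hgt (nf i j l) = l - int i"
proof -
  have one: "hgt \<one> = 0" by (simp add: one_BS hgt_wc)
  have inv: "hgt (inv x) = - hgt x" if "x \<in> carrier G" for x
    using hgt_mult[of x "inv x"] that one by simp
  have npow: "hgt (x [^] n) = int n * hgt x" if "x \<in> carrier G" for x and n :: nat
    using that by (induction n) (auto simp: one hgt_mult algebra_simps)
  have ipow: "hgt (x [^] k) = k * hgt x" if "x \<in> carrier G" for x and k :: int
    using that by (cases k rule: int_cases2) (auto simp: int_pow_int int_pow_neg_int npow inv)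
  have "hgt ga = 0" "hgt gt = 1" by (simp_all add: ga_def gt_def hgt_wc)
  then show ?thesis unfolding nf_def using gens_closed by (simp add: hgt_mult inv npow ipow)
qed

lemma hgt_kernel_comm:
  assumes "x \<in> carrier G" "y \<in> carrier G" "hgt x = 0" "hgt y = 0"
  shows "x \<otimes> y = y \<otimes> x"
proof -
  have raise: "\<exists>j'. nf i j (int i) = nf (i + d) j' (int (i + d))" for i j d
  proof (induction d)
    case (Suc d)
    then obtain j' where "nf i j (int i) = nf (i + d) j' (int (i + d))" by blast
    then show ?case using nf_raise[of "i + d" j' "int (i + d)"] by (metis add_Suc_right of_nat_Suc add.commute)
  qed auto
  have ex: "\<exists>i j. x = nf i j (int i)" if "x \<in> carrier G" "hgt x = 0" for x
  proof -
    obtain u where "x = wc u" using \<open>x \<in> carrier G\<close> carrier_BS by auto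
    then obtain i j l where "x = nf i j l" using nf_exists[of u] by auto
    then show ?thesis using hgt_nf[of i j l] that by auto
  qed
  obtain i j i' j' where "x = nf i j (int i)" "y = nf i' j' (int i')"
    using ex[of x] ex[of y] assms by blast
  moreover obtain k where "nf i j (int i) = nf (i + i') k (int (i + i'))" using raise by blast
  moreover obtain k' where "nf i' j' (int i') = nf (i' + i) k' (int (i' + i))" using raise by blast
  ultimately show ?thesis by (simp add: nf_height_0_comm add.commute del: of_nat_add)
qed

lemma height_group_BS1:
  assumes "finite_generating_set G Y"
  shows "height_group G Y hgt tr (of_int N) gt ga"
proof unfold_locales
  show "finite_generating_set G Y" by (rule assms)
  show "hgt (x \<otimes> y) = hgt x + hgt y" if "x \<in> carrier G" "y \<in> carrier G" for x y
    using that by (rule hgt_mult)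
  show "tr (x \<otimes> y) = tr x + of_int N powi hgt x * tr y"
    if "x \<in> carrier G" "y \<in> carrier G" for x y
    using that N by (auto simp: carrier_BS mult_BS tr_wc hgt_wc bs_trans_append)
  show "1 < norm (of_int N :: complex)" using N by simp
  show "x \<otimes> y = y \<otimes> x"
    if "x \<in> carrier G" "y \<in> carrier G" "hgt x = 0" "hgt y = 0" for x y
    using that by (rule hgt_kernel_comm)
qed (auto simp: gens_closed ga_def gt_def hgt_wc tr_wc carrier_BS)

end

lemma BS1_comm_tuples_negligible:
  assumes "2 \<le> \<bar>N\<bar>" "finite_generating_set (BS1 N) Y" "1 \<le> r"
  shows "exp_negligible (BS1 N) Y (r + 1) (comm_tuples (BS1 N) r)"
proof -
  have "group (BS1 N)" unfolding BS1_def by (rule group_presented_group)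
  then interpret BS "BS1 N" N using assms(1) by (simp add: BS_def BS_axioms_def)
  show ?thesis by (rule height_group.comm_tuples_exp_negligible[OF height_group_BS1[OF assms(2)] assms(3)])
qed

section \<open>Semidirect products of \<open>\<int>\<^sup>m\<close> with \<open>\<int>\<close>\<close>

lemma ex_left_eigenvector:
  fixes T :: "int mat" and ev :: complex
  assumes T: "T \<in> carrier_mat m m" and ev: "eigenvalue (map_mat of_int T) ev"
  obtains w where "w \<in> carrier_vec m" "w \<noteq> 0\<^sub>v m"
    "\<And>v. v \<in> carrier_vec m \<Longrightarrow> w \<bullet> map_vec of_int (T *\<^sub>v v) = ev * (w \<bullet> map_vec of_int v)"
proof -
  let ?A = "map_mat complex_of_int T"
  have A: "?A \<in> carrier_mat m m" "transpose_mat ?A \<in> carrier_mat m m" using T by auto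
  have "eigenvalue (transpose_mat ?A) ev"
    using ev by (simp add: eigenvalue_root_char_poly[OF A(1)] eigenvalue_root_char_poly[OF A(2)]
        char_poly_transpose_mat[OF A(1)])
  then obtain w where w: "w \<in> carrier_vec m" "w \<noteq> 0\<^sub>v m" "transpose_mat ?A *\<^sub>v w = ev \<cdot>\<^sub>v w"
    using A by (auto simp: eigenvalue_def eigenvector_def)
  have "w \<bullet> map_vec of_int (T *\<^sub>v v) = ev * (w \<bullet> map_vec of_int v)" if v: "v \<in> carrier_vec m" for v
  proof -
    have v': "map_vec complex_of_int v \<in> carrier_vec m" using v by auto
    have "w \<bullet> map_vec of_int (T *\<^sub>v v) = w \<bullet> (?A *\<^sub>v map_vec of_int v)"
      by (simp add: of_int_hom.mult_mat_vec_hom[OF T v])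
    also have "\<dots> = (transpose_mat ?A *\<^sub>v w) \<bullet> map_vec of_int v"
      by (rule transpose_vec_mult_scalar[OF A(1) v' w(1), symmetric])
    also have "\<dots> = ev * (w \<bullet> map_vec of_int v)" using w v' by simp
    finally show ?thesis .
  qed
  then show ?thesis using that w by blast
qed

text \<open>
  A left eigenvector \<open>w\<close> of \<open>T\<close> for \<open>ev\<close> turns the action of \<open>T\<close> on \<open>\<int>\<^sup>m\<close> into multiplication by \<open>ev\<close>, so
  \<open>(u, k)\<close> acts by \<open>z \<mapsto> ev\<^sup>k z + w \<bullet> u\<close>.  The unit vector of an index where \<open>w\<close> is nonzero serves as \<open>a\<close>.
\<close>

lemma height_group_semidirect:
  assumes T: "T \<in> carrier (SL_int m)" and ev: "eigenvalue (map_mat of_int T) ev" "1 < cmod ev"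
    and Y: "finite_generating_set (semidirect_Z m T) Y"
  shows "\<exists>\<beta> a. height_group (semidirect_Z m T) Y snd \<beta> ev (0\<^sub>v m, 1) a"
proof -
  let ?G = "semidirect_Z m T"
  interpret SL: group "SL_int m" by (rule group_SL_int)
  interpret G: group ?G by (rule group_semidirect_Z[OF T])
  let ?P = "\<lambda>k::int. T [^]\<^bsub>SL_int m\<^esub> k"
  have Tm: "T \<in> carrier_mat m m" using T by (simp add: SL_int_def)
  have P: "?P k \<in> carrier_mat m m" for k
    using SL.int_pow_closed[OF T, of k] by (simp add: SL_int_def)
  have P0: "?P 0 = 1\<^sub>m m" by (simp add: SL_int_def)
  have P1: "?P 1 = T" using SL.int_pow_1[OF T] by simp
  have Padd: "?P (k + l) = ?P k * ?P l" for k l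
    using SL.int_pow_mult[OF T, of k l] by (simp add: SL_int_def)
  have Pv: "?P k *\<^sub>v v \<in> carrier_vec m" if "v \<in> carrier_vec m" for k v
    using mult_mat_vec_carrier[OF P that] .
  have ev0: "ev \<noteq> 0" using ev(2) by auto
  obtain w where w: "w \<in> carrier_vec m" "w \<noteq> 0\<^sub>v m"
    and wT: "\<And>v. v \<in> carrier_vec m \<Longrightarrow> w \<bullet> map_vec of_int (T *\<^sub>v v) = ev * (w \<bullet> map_vec of_int v)"
    using ex_left_eigenvector[OF Tm ev(1)] by blast
  define \<phi> where "\<phi> v = w \<bullet> map_vec complex_of_int v" for v
  have nat: "\<phi> (?P (int n) *\<^sub>v v) = ev ^ n * \<phi> v" if v: "v \<in> carrier_vec m" for n v
  proof (induction n)
    case 0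
    then show ?case using v by (simp only: of_nat_0 P0) simp
  next
    case (Suc n)
    have "?P (int (Suc n)) = T * ?P (int n)" using Padd[of 1 "int n"] by (simp only: P1 of_nat_Suc)
    then have "?P (int (Suc n)) *\<^sub>v v = T *\<^sub>v (?P (int n) *\<^sub>v v)"
      using assoc_mult_mat_vec[OF Tm P v] by simp
    then show ?case using wT[OF Pv[OF v]] Suc by (simp add: \<phi>_def)
  qed
  have \<phi>P: "\<phi> (?P k *\<^sub>v v) = ev powi k * \<phi> v" if v: "v \<in> carrier_vec m" for k v
  proof (cases k rule: int_cases2)
    case (nonneg n)
    then show ?thesis using nat[OF v] by simp
  next
    case (nonpos n)
    have "?P (int n) *\<^sub>v (?P k *\<^sub>v v) = ?P (int n + k) *\<^sub>v v"
      unfolding Padd by (rule assoc_mult_mat_vec[OF P P v, symmetric])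
    also have "int n + k = 0" using nonpos by simp
    also have "?P 0 *\<^sub>v v = v" using v by (simp only: P0) simp
    finally have "\<phi> v = ev ^ n * \<phi> (?P k *\<^sub>v v)" using nat[OF Pv[OF v], of n k] by simp
    then show ?thesis using ev0 by (simp add: nonpos power_int_minus field_simps)
  qed
  have \<phi>add: "\<phi> (u + v) = \<phi> u + \<phi> v" if "u \<in> carrier_vec m" "v \<in> carrier_vec m" for u v
  proof -
    have "map_vec complex_of_int (u + v) = map_vec of_int u + map_vec of_int v"
      using that by (intro eq_vecI) auto
    then show ?thesis using that w by (simp add: \<phi>_def scalar_prod_add_distrib[of _ m])
  qed
  obtain i where i: "i < m" "w $ i \<noteq> 0" using w by (metis carrier_vecD eq_vecI index_zero_vec)
  have "map_vec complex_of_int (unit_vec m i) = unit_vec m i" by (intro eq_vecI) (auto simp: unit_vec_def)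
  then have \<phi>e: "\<phi> (unit_vec m i) \<noteq> 0" using i w by (simp add: \<phi>_def)
  have "height_group ?G Y snd (\<lambda>x. \<phi> (fst x)) ev (0\<^sub>v m, 1) (unit_vec m i, 0)"
  proof unfold_locales
    show "finite_generating_set ?G Y" by (rule Y)
    show "1 < cmod ev" by (rule ev(2))
    show "\<phi> (fst (unit_vec m i, 0)) \<noteq> 0" using \<phi>e by simp
    fix x y assume "x \<in> carrier ?G" "y \<in> carrier ?G"
    then obtain u k v l where xy: "x = (u, k)" "y = (v, l)" "u \<in> carrier_vec m" "v \<in> carrier_vec m"
      by (auto simp: semidirect_Z_def)
    show "snd (x \<otimes>\<^bsub>?G\<^esub> y) = snd x + snd y" by (simp add: xy semidirect_Z_def)
    show "\<phi> (fst (x \<otimes>\<^bsub>?G\<^esub> y)) = \<phi> (fst x) + ev powi snd x * \<phi> (fst y)"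
      using xy Pv by (simp add: semidirect_Z_def \<phi>add \<phi>P)
    show "x \<otimes>\<^bsub>?G\<^esub> y = y \<otimes>\<^bsub>?G\<^esub> x" if "snd x = 0" "snd y = 0"
      using xy that P0 by (simp add: semidirect_Z_def comm_add_vec[of _ m])
  qed (auto simp: semidirect_Z_def)
  then show ?thesis by blast
qed

section \<open>Both families of groups\<close>

theorem theorem1p3:
  fixes r :: nat
  assumes "r \<ge> 1"
  shows "(\<forall>N::int. \<bar>N\<bar> \<ge> 2 \<longrightarrow>
            (\<forall>Y. finite_generating_set (BS1 N) Y \<longrightarrow>
              exp_negligible (BS1 N) Y (r + 1) (comm_tuples (BS1 N) r)))
       \<and> (\<forall>(m::nat) (T::int mat).
            m \<ge> 1 \<longrightarrow> T \<in> carrier (SL_int m) \<longrightarrow>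
            (\<exists>ev::complex. eigenvalue (map_mat of_int T) ev \<and> cmod ev > 1) \<longrightarrow>
            (\<forall>Y. finite_generating_set (semidirect_Z m T) Y \<longrightarrow>
              exp_negligible (semidirect_Z m T) Y (r + 1) (comm_tuples (semidirect_Z m T) r)))"
proof (intro conjI allI impI)
  fix N :: int and Y
  assume "2 \<le> \<bar>N\<bar>" "finite_generating_set (BS1 N) Y"
  then show "exp_negligible (BS1 N) Y (r + 1) (comm_tuples (BS1 N) r)"
    using assms by (rule BS1_comm_tuples_negligible)
next
  fix m :: nat and T :: "int mat" and Y
  assume *: "T \<in> carrier (SL_int m)" "\<exists>ev::complex. eigenvalue (map_mat of_int T) ev \<and> cmod ev > 1"
    "finite_generating_set (semidirect_Z m T) Y"
  then obtain ev :: complex where "eigenvalue (map_mat of_int T) ev" "1 < cmod ev" by blast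
  then obtain \<beta> a where "height_group (semidirect_Z m T) Y snd \<beta> ev (0\<^sub>v m, 1) a"
    using height_group_semidirect * by blast
  then show "exp_negligible (semidirect_Z m T) Y (r + 1) (comm_tuples (semidirect_Z m T) r)"
    using assms by (rule height_group.comm_tuples_exp_negligible)
qed

end
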